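(* Let $g,\alpha^2,h>0$, $\theta\in(0,1)$, $m=\sqrt g h/(\pi\alpha)$, and $\eta_2=-(g-\alpha^2\partial_x^2)^{-1}\chi$ with \[ \chi(x)=\frac{1}{8h^2}\frac{1+\cos(\pi\theta)\cosh(\pi x/h)}{(\cosh(\pi x/h)+\cos(\pi\theta))^2}. \] Then $\eta_2(0)<0$ and $\eta_2''(0)>0$. When $\theta\le1/2$, $\eta_2$ is everywhere negative and strictly increasing on $[0,\infty)$. When $\theta>1/2$: (i) if $m>1/(2\theta)$, then $\eta_2(x)>0$ for all sufficiently large $|x|$; in particular $\eta_2$ has crests (positive local maxima) on either side of the origin; (ii) if $m\le1/(2\theta)$, then $\eta_2(x)<0$ for all sufficiently large $|x|$. Furthermore, for any $\theta\in(0,1)$: (i) if $m>1$, then $\displaystyle\lim_{x\to\infty}\eta_2(x)e^{\pi x/h}=-\frac{2}{m^2-1}\frac{\cos(\pi\theta)}{8\pi^2\alpha^2}$; (ii) if $m=1$, then $\displaystyle\lim_{x\to\infty}\eta_2(x)\frac{e^{\pi x/h}}{\pi x/h}=-\frac{\cos(\pi\theta)}{8\pi^2\alpha^2}$; (iii) if $m<1$, then $\displaystyle\lim_{x\to\infty}\eta_2(x)e^{\sqrt g x/\alpha}=-\frac{\pi}{\sin(m\pi)}\frac{\cos(m\pi\theta)}{8\pi^2\alpha^2}$.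
   Context: $(g-\alpha^2\partial_x^2)^{-1}$ is the Fourier multiplier with symbol $(g+\alpha^2\xi^2)^{-1}$. The function $\eta_2$ is the leading-order ($\varepsilon^2$) term of the surface profile of small solitary gravity-capillary waves on depth $h$ with a point vortex of strength $\varepsilon$ at $(0,-(1-\theta)h)$. *)

theory Defs
  imports "HOL-Analysis.Analysis"
begin

definition chi :: "real \<Rightarrow> real \<Rightarrow> real \<Rightarrow> real" where
  "chi h \<theta> x = 1 / (8 * h^2) *
     (1 + cos (pi * \<theta>) * cosh (pi * x / h)) / (cosh (pi * x / h) + cos (pi * \<theta>))^2"

definition fourier :: "(real \<Rightarrow> real) \<Rightarrow> real \<Rightarrow> complex" where
  "fourier f \<xi> = (LINT x|lborel. cis (- (x * \<xi>)) * complex_of_real (f x))"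

definition fourier_multiplier :: "(real \<Rightarrow> real) \<Rightarrow> (real \<Rightarrow> real) \<Rightarrow> real \<Rightarrow> complex" where
  "fourier_multiplier \<sigma> f x =
     (LINT \<xi>|lborel. cis (x * \<xi>) * complex_of_real (\<sigma> \<xi>) * fourier f \<xi>) / complex_of_real (2 * pi)"

text \<open>eta_2 = - (g - alpha^2 d^2/dx^2)^{-1} chi, the multiplier having symbol 1/(g + alpha^2 xi^2).
  The result is real (chi is real and even); we take the real part.\<close>
definition eta2 :: "real \<Rightarrow> real \<Rightarrow> real \<Rightarrow> real \<Rightarrow> real \<Rightarrow> real" where
  "eta2 g \<alpha> h \<theta> x =
     - Re (fourier_multiplier (\<lambda>\<xi>. 1 / (g + \<alpha>^2 * \<xi>^2)) (chi h \<theta>) x)"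

definition is_crest :: "(real \<Rightarrow> real) \<Rightarrow> real \<Rightarrow> bool" where
  "is_crest f x \<longleftrightarrow> f x > 0 \<and> (\<exists>\<epsilon>>0. \<forall>y. \<bar>y - x\<bar> < \<epsilon> \<longrightarrow> f y \<le> f x)"

end

theory Submission
  imports Defs "HOL-Probability.Sinc_Integral" "HOL-Complex_Analysis.Complex_Analysis"
begin

text \<open>
  The multiplier is convolution with \<open>exp (- (sqrt g / \<alpha>) * \<bar>x\<bar>) / (2 * \<alpha> * sqrt g)\<close>. In the variable
  \<open>t = pi x / h\<close> this makes \<open>\<eta>\<^sub>2\<close> a negative multiple of
  \<open>F t = exp (- m t) * A t + exp (m t) * A (- t)\<close>, where \<open>A\<close> is the primitive of
  \<open>exp (m t) * f t\<close> vanishing at \<open>- \<infinity>\<close> and \<open>f\<close> is the rescaled \<open>\<chi>\<close>.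
  The signs and the monotonicity come from comparing \<open>A\<close> with elementary functions that also vanish
  at \<open>- \<infinity>\<close>. The asymptotics follow from \<open>exp t * f t \<rightarrow> 2 * cos (pi * \<theta>)\<close> by
  l'Hospital's rule, together with, for \<open>m < 1\<close>, the value of \<open>A\<close> at \<open>\<infinity>\<close>; that value vanishes
  exactly when \<open>m * \<theta> = 1 / 2\<close>, and then the term of order \<open>exp (- t)\<close> decides the sign.
\<close>

section \<open>The kernel of the multiplier\<close>

text \<open>For \<open>c = cos (pi * \<theta>) < 0\<close> the profile \<open>f\<close> changes sign
  at \<open>cosh t = - 1 / c\<close>, so neither the sign of \<open>F\<close> at the origin nor its
  curvature there can be read off the integrand. Two facts hold for every \<theta> all the same:
  \<open>f\<close> has the odd primitive \<open>sinh t / (cosh t + c)\<close>, which has the sign of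
  \<open>t\<close>, and \<open>f\<close> has a strict global maximum at 0. The first gives
  \<open>F 0 > 0\<close>. The second gives \<open>F'' < 0\<close> at 0, by way of the equation
  \<open>F'' = m^2 * F - 2 * m * f\<close>. The threshold \<open>1 / (2 * \<theta>)\<close> is where
  \<open>cos (m * pi * \<theta>)\<close> changes sign. Two decay rates compete at infinity:
  \<open>exp (- m t)\<close> from the kernel, with coefficient
  \<open>2 * m * pi * cos (m * pi * \<theta>) / sin (m * pi)\<close> when \<open>m < 1\<close>, and
  \<open>exp (- t)\<close> inherited from \<open>f\<close>, with a coefficient of the sign of
  \<open>c * (m - 1)\<close>; at \<open>m = 1\<close> they resonate and produce a factor
  \<open>t\<close>. For \<open>\<theta> > 1 / 2\<close> the threshold is below 1, so the values
  \<open>m\<close> up to it all belong to the regime of the kernel, whereas those beyond it meet all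
  three regimes.\<close>

lemma integrable_cauchy_density: "integrable lborel (\<lambda>x::real. 1 / (1 + x\<^sup>2))"
  using integrable_inverse_1_plus_square by (simp add: set_integrable_def inverse_eq_divide)

lemma integral_cauchy_density: "(LINT x|lborel. 1 / (1 + x\<^sup>2)) = pi"
  using LBINT_inverse_1_plus_square
  by (simp add: interval_lebesgue_integral_def set_lebesgue_integral_def inverse_eq_divide)

lemma tendsto_indicator_interval:
  "((\<lambda>n. indicator {- real n..real n} x *\<^sub>R (f :: 'a :: real_normed_vector)) \<longlonglongrightarrow> f)"
proof (rule tendsto_eventually)
  obtain N where N: "\<bar>x\<bar> \<le> real N" using real_arch_simple by blast
  show "\<forall>\<^sub>F n in sequentially. indicator {- real n..real n} x *\<^sub>R f = f"
    using eventually_ge_at_top[of N]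
  proof eventually_elim
    case (elim n)
    then have "\<bar>x\<bar> \<le> real n" using N by linarith
    then show ?case by (auto simp: indicator_def)
  qed
qed

text \<open>Subtracting the constant \<open>exp (- z)\<close> from \<open>exp (\<i> * z * w)\<close> removes the pole of the integrand at
  \<open>w = \<i>\<close> without spoiling its quadratic decay, so that it has a primitive on \<open>Im w > -1\<close> and its
  integral over \<open>[-R, R]\<close> is bounded along the other three sides of a square.\<close>

lemma fourier_cauchy_density_nonneg:
  assumes z: "z \<ge> 0"
  shows "(LINT x|lborel. cis (z * x) / complex_of_real (1 + x\<^sup>2)) = complex_of_real (pi * exp (- z))"
proof -
  define N where "N = (\<lambda>w::complex. exp (\<i> * of_real z * w))"
  define S where "S = {w::complex. Im w > -1}"
  have S: "open S" "convex S"
    unfolding S_def by (auto intro: open_halfspace_Im_gt convex_halfspace_Im_gt)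
  \<comment> \<open>The value at \<open>\<i>\<close> is the one that makes the quotient holomorphic
    across its removable singularity, in the form expected by
    \<open>pole_lemma_open\<close>.\<close>
  define G where "G = (\<lambda>w. if w = \<i> then deriv N \<i> else (N w - N \<i>) / (w - \<i>))"
  define H where "H = (\<lambda>w. G w / (w + \<i>))"
  have "N holomorphic_on S" unfolding N_def by (intro holomorphic_intros)
  from pole_lemma_open[OF this S(1)] have "G holomorphic_on S" unfolding G_def .
  then have "H holomorphic_on S" unfolding H_def
    by (intro holomorphic_intros) (auto simp: S_def complex_eq_iff)
  from holomorphic_convex_primitive'[OF S(2,1) this]
  obtain P where P: "\<And>w. w \<in> S \<Longrightarrow> (P has_field_derivative H w) (at w within S)" by blast
  have Heq: "H w = (N w - exp (- of_real z)) / (1 + w\<^sup>2)" if "w \<noteq> \<i>" for w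
    unfolding H_def G_def using that
    by (simp add: N_def power2_eq_square algebra_simps)
  have normH: "cmod (H w) \<le> 2 / (R\<^sup>2 - 1)" if "Im w \<ge> 0" "R > 1" "cmod w \<ge> R" for w R
  proof -
    have "w \<noteq> \<i>" using that by auto
    have "cmod (N w) \<le> 1" using z that unfolding N_def by simp
    moreover have "cmod (exp (- complex_of_real z)) \<le> 1" using z by simp
    ultimately have n: "cmod (N w - exp (- of_real z)) \<le> 2"
      using norm_triangle_ineq4[of "N w" "exp (- of_real z)"] by linarith
    have "R\<^sup>2 \<le> (cmod w)\<^sup>2" using that by (intro power_mono) auto
    also have "cmod w ^ 2 = cmod (w\<^sup>2)" by (simp add: norm_power)
    also have "\<dots> \<le> cmod (1 + w\<^sup>2) + 1" using norm_triangle_ineq4[of "1 + w\<^sup>2" 1] by simp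
    finally have d: "R\<^sup>2 - 1 \<le> cmod (1 + w\<^sup>2)" by simp
    have "R\<^sup>2 > 1" using that(2) by simp
    then show ?thesis unfolding Heq[OF \<open>w \<noteq> \<i>\<close>] norm_divide using n d
      by (intro frac_le) auto
  qed
  have step: "cmod (P a - P b) \<le> 2 / (R\<^sup>2 - 1) * cmod (a - b)"
    if T: "convex T" "a \<in> T" "b \<in> T" "\<And>w. w \<in> T \<Longrightarrow> Im w \<ge> 0 \<and> cmod w \<ge> R" and R: "R > 1" for T a b R
  proof (rule field_differentiable_bound[OF T(1) _ _ T(2,3)])
    fix w assume w: "w \<in> T"
    show "cmod (H w) \<le> 2 / (R\<^sup>2 - 1)" using T(4)[OF w] normH R by auto
    have "T \<subseteq> S" using T(4) unfolding S_def by force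
    show "(P has_field_derivative H w) (at w within T)"
      using P[of w] w \<open>T \<subseteq> S\<close> by (meson DERIV_subset subsetD)
  qed
  \<comment> \<open>The three sides have lengths \<open>R\<close>, \<open>2 * R\<close> and
    \<open>R\<close>, hence \<open>4 * R\<close> times the bound \<open>2 / (R^2 - 1)\<close> for
    the integrand.\<close>
  have bound: "cmod (P (of_real R) - P (of_real (- R))) \<le> 8 * R / (R\<^sup>2 - 1)" if R: "R > 1" for R
  proof -
    \<comment> \<open>The mean value bound needs convex sets. The region \<open>cmod w >= R\<close>
      is not convex, but each side lies in a convex piece of it.\<close>
    have cv: "convex {w. Im w \<ge> 0 \<and> Re w \<ge> R}" "convex {w. Im w \<ge> R}"
      "convex {w. Im w \<ge> 0 \<and> Re w \<le> - R}"
      by (auto intro!: convex_Int convex_halfspace_Im_ge convex_halfspace_Re_ge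
          convex_halfspace_Re_le simp: Collect_conj_eq)
    have n: "cmod w \<ge> R" if "Re w \<ge> R \<or> Im w \<ge> R \<or> Re w \<le> - R" for w
      using that abs_Re_le_cmod[of w] abs_Im_le_cmod[of w] by linarith
    have 1: "cmod (P (of_real R) - P (Complex R R)) \<le> 2 / (R\<^sup>2 - 1) * cmod (of_real R - Complex R R)"
      by (rule step[OF cv(1)]) (use R n in auto)
    have 2: "cmod (P (Complex R R) - P (Complex (-R) R)) \<le> 2 / (R\<^sup>2 - 1) * cmod (Complex R R - Complex (-R) R)"
      by (rule step[OF cv(2)]) (use R n in auto)
    have 3: "cmod (P (Complex (-R) R) - P (of_real (- R))) \<le> 2 / (R\<^sup>2 - 1) * cmod (Complex (-R) R - of_real (- R))"
      by (rule step[OF cv(3)]) (use R n in auto)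
    have c: "cmod (of_real R - Complex R R) = R" "cmod (Complex R R - Complex (-R) R) = 2 * R"
      "cmod (Complex (-R) R - of_real (- R)) = R" using R
      by (simp_all add: cmod_def real_sqrt_mult)
    have "cmod (P (of_real R) - P (of_real (- R))) \<le> cmod (P (of_real R) - P (Complex R R))
      + cmod (P (Complex R R) - P (Complex (-R) R)) + cmod (P (Complex (-R) R) - P (of_real (- R)))"
      by norm
    also have "\<dots> \<le> 2 / (R\<^sup>2 - 1) * R + 2 / (R\<^sup>2 - 1) * (2 * R) + 2 / (R\<^sup>2 - 1) * R"
      using 1 2 3 unfolding c by linarith
    finally show ?thesis by (simp add: field_simps)
  qed
  define q where "q = (\<lambda>x::real. (cis (z * x) - of_real (exp (- z))) / complex_of_real (1 + x\<^sup>2))"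
  have Hq: "H (of_real x) = q x" for x
  proof -
    have "of_real x \<noteq> \<i>" by (simp add: complex_eq_iff)
    from Heq[OF this] show ?thesis
      unfolding q_def N_def by (simp add: cis_conv_exp mult.assoc flip: exp_of_real)
  qed
  have pos: "1 + x\<^sup>2 \<noteq> 0" for x::real using zero_le_power2[of x] by linarith
  have cq: "continuous_on A q" for A
    unfolding q_def by (intro continuous_intros) (simp only: of_real_eq_0_iff pos not_False_eq_True simp_thms Ball_def)
  then have [measurable]: "q \<in> borel_measurable borel"
    by (intro borel_measurable_continuous_onI)
  have nq: "cmod (q x) \<le> 2 * (1 / (1 + x\<^sup>2))" for x
  proof -
    have "cmod (cis (z * x) - of_real (exp (- z))) \<le> cmod (cis (z * x)) + cmod (of_real (exp (- z)))"
      by (rule norm_triangle_ineq4)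
    also have "\<dots> \<le> 2" using z by simp
    finally show ?thesis unfolding q_def norm_divide norm_of_real
      by (simp add: divide_right_mono)
  qed
  have intq: "integrable lborel q"
    by (rule Bochner_Integration.integrable_bound[OF integrable_mult_right[OF integrable_cauchy_density, of 2]])
       (use nq in auto)
  have "(\<lambda>n. LINT x|lborel. indicator {- real n..real n} x *\<^sub>R q x) \<longlonglongrightarrow> (LINT x|lborel. q x)"
  proof (rule integral_dominated_convergence[where w = "\<lambda>x. cmod (q x)"])
    show "AE x in lborel. (\<lambda>n. indicat_real {- real n..real n} x *\<^sub>R q x) \<longlonglongrightarrow> q x"
      by (intro AE_I2 tendsto_indicator_interval)
  qed (use intq in \<open>auto simp: indicator_def\<close>)
  moreover have "(LINT x|lborel. indicator {- real n..real n} x *\<^sub>R q x) = P (of_real n) - P (of_real (- n))" for n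
  proof (rule integral_FTC_atLeastAtMost)
    fix x
    have "(P has_field_derivative H (of_real x)) (at (of_real x))"
      using P[of "of_real x"] S(1) at_within_open[of "of_real x" S] by (auto simp: S_def)
    then show "((\<lambda>x. P (of_real x)) has_vector_derivative q x) (at x within {- real n..real n})"
      using Hq has_vector_derivative_real_field by metis
  qed (use cq in auto)
  moreover have "(\<lambda>n. P (of_real (real n)) - P (of_real (- real n))) \<longlonglongrightarrow> 0"
  proof (rule Lim_null_comparison)
    show "\<forall>\<^sub>F n in sequentially. cmod (P (of_real (real n)) - P (of_real (- real n))) \<le> 8 * real n / ((real n)\<^sup>2 - 1)"
      using eventually_gt_at_top[of 1] by eventually_elim (rule bound, simp)
    show "(\<lambda>n. 8 * real n / ((real n)\<^sup>2 - 1)) \<longlonglongrightarrow> 0" by real_asymp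
  qed
  ultimately have q0: "(LINT x|lborel. q x) = 0"
    by (metis (no_types, lifting) LIMSEQ_unique ext)
  \<comment> \<open>The integral of \<open>q\<close> vanishes, so the subtracted constant, with its
    \<open>exp (- z)\<close> times the Cauchy density, carries the whole value.\<close>
  define r where "r = (\<lambda>x::real. complex_of_real (exp (- z)) * complex_of_real (1 / (1 + x\<^sup>2)))"
  have intr: "integrable lborel r"
    unfolding r_def using integrable_cauchy_density by (intro integrable_mult_right integrable_of_real)
  have "(LINT x|lborel. cis (z * x) / complex_of_real (1 + x\<^sup>2)) = (LINT x|lborel. q x + r x)"
    unfolding q_def r_def by (intro Bochner_Integration.integral_cong) (auto simp: diff_divide_distrib)
  also have "\<dots> = (LINT x|lborel. r x)"
    using intq intr q0 by simp
  also have "\<dots> = complex_of_real (exp (- z)) * complex_of_real pi"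
    unfolding r_def by (simp only: integral_mult_right_zero integral_complex_of_real integral_cauchy_density)
  finally show ?thesis by (simp add: mult.commute)
qed

lemma fourier_cauchy_density:
  "(LINT x|lborel. cis (z * x) / complex_of_real (1 + x\<^sup>2)) = complex_of_real (pi * exp (- \<bar>z\<bar>))"
proof (cases "z \<ge> 0")
  case False
  then show ?thesis
    using fourier_cauchy_density_nonneg[of "- z"]
      lborel_integral_real_affine[of "-1" "\<lambda>x. cis (z * x) / complex_of_real (1 + x\<^sup>2)" 0]
    by simp
qed (use fourier_cauchy_density_nonneg[of z] in simp)

lemma borel_measurable_cis [measurable]: "cis \<in> borel_measurable borel"
  by (intro borel_measurable_continuous_onI continuous_intros)

context
  fixes g \<alpha> :: real
  assumes g: "g > 0" and \<alpha>: "\<alpha> > 0"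
begin

text \<open>The \<open>0 +\<close> is the trivial translation in the affine substitution rule for
  Lebesgue integrals, whose shape this right-hand side matches.\<close>

lemma symbol_rescale: "1 / (g + \<alpha>\<^sup>2 * \<xi>\<^sup>2) = 1 / g * (1 / (1 + (0 + (\<alpha> / sqrt g) * \<xi>)\<^sup>2))"
  using g \<alpha> by (simp add: power_mult_distrib power_divide field_simps)

lemma integrable_symbol: "integrable lborel (\<lambda>\<xi>. 1 / (g + \<alpha>\<^sup>2 * \<xi>\<^sup>2))"
  unfolding symbol_rescale
  by (intro integrable_mult_right lborel_integrable_real_affine[OF integrable_cauchy_density]) (use g \<alpha> in simp)

lemma fourier_symbol:
  "(LINT \<xi>|lborel. cis (w * \<xi>) * complex_of_real (1 / (g + \<alpha>\<^sup>2 * \<xi>\<^sup>2)))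
    = complex_of_real (pi / (\<alpha> * sqrt g) * exp (- (sqrt g / \<alpha>) * \<bar>w\<bar>))"
proof -
  have eq: "cis (w * (0 + sqrt g / \<alpha> * \<xi>)) * complex_of_real (1 / (g + \<alpha>\<^sup>2 * (0 + sqrt g / \<alpha> * \<xi>)\<^sup>2))
    = complex_of_real (1 / g) * (cis ((w * (sqrt g / \<alpha>)) * \<xi>) / complex_of_real (1 + \<xi>\<^sup>2))" for \<xi>
  proof -
    have "g + \<alpha>\<^sup>2 * (0 + sqrt g / \<alpha> * \<xi>)\<^sup>2 = g * (1 + \<xi>\<^sup>2)"
      using g \<alpha> by (simp add: power_mult_distrib power_divide field_simps)
    then have "1 / (g + \<alpha>\<^sup>2 * (0 + sqrt g / \<alpha> * \<xi>)\<^sup>2) = 1 / g * (1 / (1 + \<xi>\<^sup>2))" by simp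
    then have "complex_of_real (1 / (g + \<alpha>\<^sup>2 * (0 + sqrt g / \<alpha> * \<xi>)\<^sup>2))
        = complex_of_real (1 / g) * (1 / complex_of_real (1 + \<xi>\<^sup>2))"
      by (simp only: of_real_mult of_real_divide of_real_1)
    moreover have "w * (0 + sqrt g / \<alpha> * \<xi>) = (w * (sqrt g / \<alpha>)) * \<xi>" by simp
    ultimately show ?thesis by (metis (no_types, lifting) mult.left_commute mult.right_neutral times_divide_eq_right)
  qed
  have k: "sqrt g / \<alpha> > 0" using g \<alpha> by simp
  have "(LINT \<xi>|lborel. cis (w * \<xi>) * complex_of_real (1 / (g + \<alpha>\<^sup>2 * \<xi>\<^sup>2)))
    = \<bar>sqrt g / \<alpha>\<bar> *\<^sub>R (LINT \<xi>|lborel. complex_of_real (1 / g) *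
         (cis ((w * (sqrt g / \<alpha>)) * \<xi>) / complex_of_real (1 + \<xi>\<^sup>2)))"
    using k by (subst lborel_integral_real_affine[where c = "sqrt g / \<alpha>" and t = 0]) (simp_all only: eq)
  also have "\<dots> = complex_of_real (sqrt g / \<alpha> * (1 / g * (pi * exp (- \<bar>w * (sqrt g / \<alpha>)\<bar>))))"
    using k by (simp only: integral_mult_right_zero fourier_cauchy_density scaleR_conv_of_real of_real_mult abs_of_pos)
  also have "sqrt g / \<alpha> * (1 / g * (pi * exp (- \<bar>w * (sqrt g / \<alpha>)\<bar>))) = pi / (\<alpha> * sqrt g) * exp (- (sqrt g / \<alpha>) * \<bar>w\<bar>)"
  proof -
    have "sqrt g / g = 1 / sqrt g" using g by (metis real_div_sqrt less_imp_le divide_divide_eq_right div_by_1 inverse_divide inverse_eq_divide)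
    moreover have "\<bar>w * (sqrt g / \<alpha>)\<bar> = sqrt g / \<alpha> * \<bar>w\<bar>" using g \<alpha> by (simp add: abs_mult mult.commute)
    ultimately show ?thesis using g \<alpha> by (simp add: field_simps)
  qed
  finally show ?thesis .
qed

text \<open>The double integrand has modulus
  \<open>\<bar>\<sigma> \<xi>\<bar> * \<bar>f y\<bar>\<close>, a product of integrable functions, so
  Fubini applies; integrating over \<xi> first leaves the transform of the symbol at
  \<open>x - y\<close>.\<close>

lemma fourier_multiplier_symbol:
  assumes f: "integrable lborel f"
  shows "fourier_multiplier (\<lambda>\<xi>. 1 / (g + \<alpha>\<^sup>2 * \<xi>\<^sup>2)) f x =
    complex_of_real (1 / (2 * \<alpha> * sqrt g) * (LINT y|lborel. exp (- (sqrt g / \<alpha>) * \<bar>x - y\<bar>) * f y))"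
proof -
  define \<sigma> where "\<sigma> = (\<lambda>\<xi>. 1 / (g + \<alpha>\<^sup>2 * \<xi>\<^sup>2))"
  have \<sigma>: "integrable lborel \<sigma>" unfolding \<sigma>_def by (rule integrable_symbol)
  have [measurable]: "\<sigma> \<in> borel_measurable borel" "f \<in> borel_measurable borel"
    using \<sigma> f borel_measurable_integrable by auto
  define \<Phi> where "\<Phi> = (\<lambda>\<xi> y. cis (x * \<xi>) * of_real (\<sigma> \<xi>) * (cis (- (y * \<xi>)) * of_real (f y)))"
  have int_inner: "integrable lborel (\<lambda>y. \<Phi> \<xi> y)" for \<xi>
    unfolding \<Phi>_def
    by (intro integrable_mult_right Bochner_Integration.integrable_bound[OF f]) (auto simp: norm_mult)
  have int: "integrable (lborel \<Otimes>\<^sub>M lborel) (case_prod \<Phi>)"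
  proof (rule lborel_pair.Fubini_integrable)
    show "case_prod \<Phi> \<in> borel_measurable (lborel \<Otimes>\<^sub>M lborel)"
      unfolding \<Phi>_def by measurable
    have "(LINT y|lborel. norm (case (\<xi>, y) of (\<xi>, y) \<Rightarrow> \<Phi> \<xi> y)) = \<bar>\<sigma> \<xi>\<bar> * (LINT y|lborel. \<bar>f y\<bar>)" for \<xi>
      unfolding \<Phi>_def by (simp add: norm_mult)
    then show "integrable lborel (\<lambda>\<xi>. LINT y|lborel. norm (case (\<xi>, y) of (\<xi>, y) \<Rightarrow> \<Phi> \<xi> y))"
      using \<sigma> by simp
  qed (use int_inner in auto)
  have "(LINT \<xi>|lborel. cis (x * \<xi>) * of_real (\<sigma> \<xi>) * fourier f \<xi>) = (LINT \<xi>|lborel. LINT y|lborel. \<Phi> \<xi> y)"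
    unfolding fourier_def \<Phi>_def by simp
  also have "\<dots> = (LINT y|lborel. LINT \<xi>|lborel. \<Phi> \<xi> y)"
    by (rule lborel_pair.Fubini_integral[OF int, symmetric])
  also have "(\<lambda>y. LINT \<xi>|lborel. \<Phi> \<xi> y) =
      (\<lambda>y. of_real (pi / (\<alpha> * sqrt g) * (exp (- (sqrt g / \<alpha>) * \<bar>x - y\<bar>) * f y)))"
  proof
    fix y
    have "\<Phi> \<xi> y = of_real (f y) * (cis ((x - y) * \<xi>) * of_real (\<sigma> \<xi>))" for \<xi>
    proof -
      have "cis ((x - y) * \<xi>) = cis (x * \<xi>) * cis (- (y * \<xi>))"
        by (simp add: cis_mult left_diff_distrib)
      then show ?thesis unfolding \<Phi>_def by (simp only: mult_ac)
    qed
    then have "(LINT \<xi>|lborel. \<Phi> \<xi> y) = of_real (f y) * (LINT \<xi>|lborel. cis ((x - y) * \<xi>) * of_real (\<sigma> \<xi>))"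
      by simp
    also have "\<dots> = of_real (f y) * of_real (pi / (\<alpha> * sqrt g) * exp (- (sqrt g / \<alpha>) * \<bar>x - y\<bar>))"
      unfolding \<sigma>_def fourier_symbol ..
    finally show "(LINT \<xi>|lborel. \<Phi> \<xi> y) = of_real (pi / (\<alpha> * sqrt g) * (exp (- (sqrt g / \<alpha>) * \<bar>x - y\<bar>) * f y))"
      by (simp add: mult_ac)
  qed
  also have "(LINT y|lborel. of_real (pi / (\<alpha> * sqrt g) * (exp (- (sqrt g / \<alpha>) * \<bar>x - y\<bar>) * f y)))
      = complex_of_real (pi / (\<alpha> * sqrt g) * (LINT y|lborel. exp (- (sqrt g / \<alpha>) * \<bar>x - y\<bar>) * f y))"
    by (simp only: integral_complex_of_real integral_mult_right_zero)
  finally show ?thesis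
    unfolding fourier_multiplier_def \<sigma>_def[symmetric] using g \<alpha>
    by (simp only: of_real_divide[symmetric]) (simp add: field_simps)
qed

end

section \<open>Convolution with a two-sided exponential\<close>

text \<open>This is the \<open>A\<close> of the overview. On the half-line the weight is at most
  \<open>exp (m * t)\<close> when \<open>m > 0\<close>, so integrability of \<open>f\<close> alone
  makes the integral converge and vanish at minus infinity.\<close>

definition exp_tail :: "(real \<Rightarrow> real) \<Rightarrow> real \<Rightarrow> real \<Rightarrow> real" where
  "exp_tail f m t = (LINT s|lborel. indicator {..t} s * (exp (m * s) * f s))"

context
  fixes f :: "real \<Rightarrow> real" and m :: real
  assumes contf: "continuous_on UNIV f" and intf: "integrable lborel f" and m: "m > 0"
begin

lemma exp_tail_integrand_le:
  "\<bar>indicator {..t} s * (exp (m * s) * f s)\<bar> \<le> exp (m * t) * \<bar>f s\<bar>"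
proof (cases "s \<le> t")
  case True
  then have "exp (m * s) \<le> exp (m * t)" using m by simp
  then show ?thesis using True by (simp add: abs_mult mult_right_mono)
qed auto

lemma integrable_exp_tail: "integrable lborel (\<lambda>s. indicator {..t} s * (exp (m * s) * f s))"
proof (rule Bochner_Integration.integrable_bound)
  show "integrable lborel (\<lambda>s. exp (m * t) * \<bar>f s\<bar>)" using intf by simp
  have [measurable]: "f \<in> borel_measurable borel"
    using contf by (rule borel_measurable_continuous_onI)
  show "(\<lambda>s. indicator {..t} s * (exp (m * s) * f s)) \<in> borel_measurable lborel" by measurable
qed (use exp_tail_integrand_le in \<open>auto simp: abs_mult\<close>)

lemma exp_tail_bound: "\<bar>exp_tail f m t\<bar> \<le> exp (m * t) * (LINT s|lborel. \<bar>f s\<bar>)"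
proof -
  have "\<bar>exp_tail f m t\<bar> \<le> (LINT s|lborel. \<bar>indicator {..t} s * (exp (m * s) * f s)\<bar>)"
    unfolding exp_tail_def by (rule integral_abs_bound)
  also have "\<dots> \<le> (LINT s|lborel. exp (m * t) * \<bar>f s\<bar>)"
    by (rule integral_mono[OF integrable_abs[OF integrable_exp_tail]])
      (use intf exp_tail_integrand_le in auto)
  finally show ?thesis by simp
qed

lemma exp_tail_at_bot: "(exp_tail f m \<longlongrightarrow> 0) at_bot"
proof (rule Lim_null_comparison)
  show "\<forall>\<^sub>F t in at_bot. norm (exp_tail f m t) \<le> exp (m * t) * (LINT s|lborel. \<bar>f s\<bar>)"
    using exp_tail_bound by simp
  have "filterlim (\<lambda>t. m * t) at_bot at_bot"
    by (rule filterlim_tendsto_pos_mult_at_bot[OF tendsto_const m filterlim_ident])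
  from filterlim_compose[OF exp_at_bot this]
  show "((\<lambda>t. exp (m * t) * (LINT s|lborel. \<bar>f s\<bar>)) \<longlongrightarrow> 0) at_bot"
    by (rule tendsto_mult_left_zero)
qed

text \<open>Links the Lebesgue integral over a half-line to the gauge integral over a compact
  interval, for which the fundamental theorem of calculus is applied next.\<close>

lemma exp_tail_diff:
  assumes "a \<le> t"
  shows "exp_tail f m t = exp_tail f m a + integral {a..t} (\<lambda>s. exp (m * s) * f s)"
proof -
  let ?g = "\<lambda>s. exp (m * s) * f s"
  have c: "continuous_on {a..t} ?g"
    by (intro continuous_intros continuous_on_subset[OF contf]) auto
  have "exp_tail f m t - exp_tail f m a =
    (LINT s|lborel. indicator {..t} s * ?g s - indicator {..a} s * ?g s)"
    unfolding exp_tail_def using integrable_exp_tail by simp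
  also have "\<dots> = (LINT s|lborel. indicator {a..t} s *\<^sub>R ?g s)"
  proof (rule integral_cong_AE)
    show "AE s in lborel. indicator {..t} s * ?g s - indicator {..a} s * ?g s = indicator {a..t} s *\<^sub>R ?g s"
      using AE_lborel_singleton[of a] by eventually_elim (use assms in \<open>auto simp: indicator_def\<close>)
    have [measurable]: "f \<in> borel_measurable borel"
      using contf by (rule borel_measurable_continuous_onI)
    show "(\<lambda>s. indicator {..t} s * ?g s - indicator {..a} s * ?g s) \<in> borel_measurable lborel"
      "(\<lambda>s. indicator {a..t} s *\<^sub>R ?g s) \<in> borel_measurable lborel" by measurable
  qed
  also have "\<dots> = integral {a..t} ?g"
    using set_borel_integral_eq_integral(2)[OF borel_integrable_atLeastAtMost'[OF c]]
    by (simp add: set_lebesgue_integral_def)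
  finally show ?thesis by simp
qed

lemma exp_tail_has_derivative:
  "(exp_tail f m has_real_derivative exp (m * t) * f t) (at t)"
proof -
  let ?g = "\<lambda>s. exp (m * s) * f s"
  have c: "continuous_on {t - 1..t + 1} ?g"
    by (intro continuous_intros continuous_on_subset[OF contf]) auto
  have "((\<lambda>x. integral {t - 1..x} ?g) has_real_derivative ?g t) (at t within {t - 1..t + 1})"
    by (rule integral_has_real_derivative[OF c]) auto
  then have "((\<lambda>x. integral {t - 1..x} ?g) has_real_derivative ?g t) (at t)"
    by (simp add: at_within_interior[of t "{t - 1..t + 1}"])
  then have "((\<lambda>x. exp_tail f m (t - 1) + integral {t - 1..x} ?g) has_real_derivative ?g t) (at t)"
    by (auto intro!: derivative_eq_intros)
  then show ?thesis
    by (rule has_field_derivative_transform_within_open[where S = "{t - 1<..}"])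
      (auto simp: exp_tail_diff[of "t - 1", symmetric])
qed

text \<open>The integral is split at \<open>s = t\<close>. The part \<open>s > t\<close> is
  reflected by \<open>s -> - s\<close>, and evenness of \<open>f\<close> turns it into a left tail
  again, now ending at \<open>- t\<close>.\<close>

lemma exp_kernel_convolution:
  assumes even: "\<And>s. f (- s) = f s"
  shows "(LINT s|lborel. exp (- m * \<bar>t - s\<bar>) * f s)
    = exp (- m * t) * exp_tail f m t + exp (m * t) * exp_tail f m (- t)"
proof -
  have [measurable]: "f \<in> borel_measurable borel"
    using contf by (rule borel_measurable_continuous_onI)
  let ?l = "\<lambda>s. indicator {..t} s * (exp (m * s) * f s)"
  let ?r = "\<lambda>s. indicator {..- t} s * (exp (m * s) * f s)"
  have ri: "integrable lborel (\<lambda>s. ?r (0 + (-1) * s))"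
    by (rule lborel_integrable_real_affine[OF integrable_exp_tail]) simp
  have re: "(LINT s|lborel. ?r (0 + (-1) * s)) = exp_tail f m (- t)"
    unfolding exp_tail_def using lborel_integral_real_affine[of "-1" ?r 0] by simp
  have "(LINT s|lborel. exp (- m * \<bar>t - s\<bar>) * f s)
    = (LINT s|lborel. exp (- m * t) * ?l s + exp (m * t) * ?r (0 + (-1) * s))"
  proof (rule integral_cong_AE)
    show "AE s in lborel. exp (- m * \<bar>t - s\<bar>) * f s
        = exp (- m * t) * ?l s + exp (m * t) * ?r (0 + (-1) * s)"
      using AE_lborel_singleton[of t]
    proof eventually_elim
      case (elim s)
      then consider "s < t" | "s > t" by linarith
      then show ?case
      proof cases
        case 1
        then have "- m * \<bar>t - s\<bar> = - m * t + m * s" by (simp add: algebra_simps)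
        then have "exp (- m * \<bar>t - s\<bar>) = exp (- m * t) * exp (m * s)"
          by (simp only: exp_add)
        with 1 show ?thesis by (simp add: indicator_def)
      next
        case 2
        then have "- m * \<bar>t - s\<bar> = m * t + - (m * s)" by (simp add: algebra_simps)
        then have "exp (- m * \<bar>t - s\<bar>) = exp (m * t) * exp (- (m * s))"
          by (simp only: exp_add)
        with 2 show ?thesis by (simp add: indicator_def even)
      qed
    qed
  qed measurable
  also have "\<dots> = exp (- m * t) * exp_tail f m t + exp (m * t) * exp_tail f m (- t)"
    using integrable_exp_tail ri re by (simp add: exp_tail_def)
  finally show ?thesis .
qed

end

section \<open>The source term\<close>

text \<open>Serves to dominate the profile by the Cauchy density. The crude factor
  \<open>1 / 4\<close> suffices: averaging the bounds for \<open>exp t\<close> and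
  \<open>exp (- t)\<close> even gives \<open>1 + t^2 / 4\<close>.\<close>

lemma cosh_ge_quadratic: "cosh t \<ge> 1 / 4 * (1 + t\<^sup>2)" for t :: real
proof -
  have *: "cosh t \<ge> 1 / 4 * (1 + t\<^sup>2)" if "t \<ge> 0" for t :: real
  proof -
    have "exp t \<ge> 1 + t + t\<^sup>2 / 2" using exp_lower_Taylor_quadratic[OF that] .
    moreover have "exp (- t) \<ge> 1 - t" using exp_ge_add_one_self[of "- t"] by simp
    ultimately show ?thesis unfolding cosh_field_def by (simp add: field_simps)
  qed
  show ?thesis using *[of t] *[of "- t"] by (cases "t \<ge> 0") auto
qed

text \<open>Up to the factor \<open>1 / (8 h\<^sup>2)\<close> this is \<open>chi\<close> in the variable \<open>t = pi x / h\<close>, with \<open>c = cos (pi \<theta>)\<close>.\<close>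

definition profile :: "real \<Rightarrow> real \<Rightarrow> real" where
  "profile c t = (1 + c * cosh t) / (cosh t + c)\<^sup>2"

lemma profile_even [simp]: "profile c (- t) = profile c t"
  by (simp add: profile_def)

context
  fixes c :: real
  assumes c: "\<bar>c\<bar> < 1"
begin

lemma cosh_plus_pos: "cosh t + c > 0"
  using c cosh_real_ge_1[of t] by linarith

lemma cosh_plus_nz [simp]: "cosh t + c \<noteq> 0" "c + cosh t \<noteq> 0"
  using cosh_plus_pos[of t] by simp_all

text \<open>By \<open>cosh^2 - sinh^2 = 1\<close>, the numerator of the derivative collapses to
  \<open>1 + c * cosh t\<close>. This primitive has the sign of \<open>t\<close> even where the
  profile is negative.\<close>

lemma profile_primitive:
  "((\<lambda>t. sinh t / (cosh t + c)) has_real_derivative profile c t) (at t)"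
  using hyperbolic_pythagoras[of t]
  by (auto intro!: derivative_eq_intros simp: profile_def power2_eq_square field_simps)

lemma profile_primitive_bound: "\<bar>sinh t / (cosh t + c)\<bar> \<le> 1 / (1 - \<bar>c\<bar>)"
proof -
  have "\<bar>sinh t\<bar> \<le> cosh t"
    using sinh_le_cosh_real[of t] sinh_le_cosh_real[of "- t"] by simp
  moreover have "(1 - \<bar>c\<bar>) * cosh t \<le> cosh t + c"
  proof -
    have "\<bar>c\<bar> \<le> \<bar>c\<bar> * cosh t" using cosh_real_ge_1[of t] by (simp add: mult_le_cancel_left1)
    then show ?thesis unfolding left_diff_distrib by linarith
  qed
  ultimately have "\<bar>sinh t / (cosh t + c)\<bar> \<le> cosh t / ((1 - \<bar>c\<bar>) * cosh t)"
    unfolding abs_divide using c cosh_real_pos[of t] cosh_plus_pos[of t] by (intro frac_le) auto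
  then show ?thesis using cosh_real_pos[of t] by simp
qed

lemma profile_deriv:
  "(profile c has_real_derivative sinh t * (c\<^sup>2 - c * cosh t - 2) / (cosh t + c) ^ 3) (at t)"
proof -
  have "((\<lambda>t. (1 + c * cosh t) / (cosh t + c)\<^sup>2) has_real_derivative
      (c * sinh t * (cosh t + c)\<^sup>2 - (1 + c * cosh t) * (2 * (cosh t + c) * sinh t)) / ((cosh t + c)\<^sup>2)\<^sup>2) (at t)"
    by (auto intro!: derivative_eq_intros simp: power2_eq_square[of "(cosh t + c)\<^sup>2"])
  also have "(c * sinh t * (cosh t + c)\<^sup>2 - (1 + c * cosh t) * (2 * (cosh t + c) * sinh t))
    = (cosh t + c) * (sinh t * (c\<^sup>2 - c * cosh t - 2))"
    by (simp add: power2_eq_square algebra_simps)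
  also have "\<dots> / ((cosh t + c)\<^sup>2)\<^sup>2 = sinh t * (c\<^sup>2 - c * cosh t - 2) / (cosh t + c) ^ 3"
    by (simp add: power2_eq_square power3_eq_cube)
  finally show ?thesis by (simp add: profile_def[abs_def])
qed

lemma profile_continuous: "continuous_on A (profile c)"
  by (rule DERIV_continuous_on, rule has_field_derivative_at_within, rule profile_deriv)

lemma profile_lt_zero_value:
  assumes "t \<noteq> 0"
  shows "profile c t < profile c 0"
proof -
  have C: "cosh t > 1" using assms cosh_real_ge_1[of t] by (metis cosh_real_one_iff order_le_less)
  have p: "cosh t + c > 0" "1 + c > 0" using cosh_plus_pos c by auto
  \<comment> \<open>The claim with denominators cleared. Both sides agree at
    \<open>cosh t = 1\<close>, hence the factor \<open>cosh t - 1\<close>; the other factor is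
    positive because \<open>c^2 < 1\<close>.\<close>
  have "(cosh t + c)\<^sup>2 - (1 + c * cosh t) * (1 + c) = (cosh t - 1) * (cosh t + 1 + c - c\<^sup>2)"
    by (simp add: power2_eq_square algebra_simps)
  moreover have "c\<^sup>2 < 1" using c by (simp add: abs_square_less_1)
  then have "cosh t + 1 + c - c\<^sup>2 > 0" using C c by linarith
  ultimately have "(1 + c * cosh t) * (1 + c) < (cosh t + c)\<^sup>2" using C
    by (smt (verit) mult_pos_pos)
  then have "(1 + c * cosh t) / (cosh t + c)\<^sup>2 < 1 / (1 + c)"
    using p by (simp add: divide_simps)
  also have "1 / (1 + c) = profile c 0" using p by (simp add: profile_def power2_eq_square)
  finally show ?thesis by (simp add: profile_def)
qed

text \<open>The constant 8 is 2 from the numerator bound \<open>2 * cosh t\<close> times 4 from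
  \<open>1 / cosh t <= 4 / (1 + t^2)\<close>.\<close>

lemma profile_bound: "\<bar>profile c t\<bar> \<le> 8 / (1 - \<bar>c\<bar>)\<^sup>2 * (1 / (1 + t\<^sup>2))"
proof -
  have C: "cosh t \<ge> 1" by (rule cosh_real_ge_1)
  define d where "d = 1 - \<bar>c\<bar>"
  have d: "d > 0" using c by (simp add: d_def)
  have cc: "\<bar>c * cosh t\<bar> \<le> cosh t" using c C by (simp add: abs_mult mult_left_le_one_le)
  have n: "\<bar>1 + c * cosh t\<bar> \<le> 2 * cosh t" using cc C by linarith
  have "\<bar>c\<bar> \<le> \<bar>c\<bar> * cosh t" using C by (simp add: mult_le_cancel_left1)
  then have "d * cosh t \<le> cosh t + c" unfolding d_def left_diff_distrib by linarith
  then have "(d * cosh t)\<^sup>2 \<le> (cosh t + c)\<^sup>2" using d C by (intro power_mono) auto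
  then have "\<bar>profile c t\<bar> \<le> 2 * cosh t / (d * cosh t)\<^sup>2"
    unfolding profile_def abs_divide using n d C by (intro frac_le) auto
  also have "\<dots> = 2 / d\<^sup>2 * (1 / cosh t)" using d C by (simp add: power2_eq_square)
  also have "\<dots> \<le> 2 / d\<^sup>2 * (1 / (1 / 4 * (1 + t\<^sup>2)))"
    using cosh_ge_quadratic[of t] C
    by (intro mult_left_mono divide_left_mono mult_pos_pos) (auto intro!: add_pos_nonneg)
  also have "\<dots> = 8 / d\<^sup>2 * (1 / (1 + t\<^sup>2))" by simp
  finally show ?thesis unfolding d_def .
qed

lemma profile_integrable: "integrable lborel (profile c)"
proof (rule Bochner_Integration.integrable_bound)
  show "integrable lborel (\<lambda>t. 8 / (1 - \<bar>c\<bar>)\<^sup>2 * (1 / (1 + t\<^sup>2)))"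
    using integrable_cauchy_density by (rule integrable_mult_right)
  show "profile c \<in> borel_measurable lborel"
    using borel_measurable_continuous_onI[OF profile_continuous] by simp
  have "norm (profile c t) \<le> norm (8 / (1 - \<bar>c\<bar>)\<^sup>2 * (1 / (1 + t\<^sup>2)))" for t
    using profile_bound[of t] by (simp add: abs_mult)
  then show "AE t in lborel. norm (profile c t) \<le> norm (8 / (1 - \<bar>c\<bar>)\<^sup>2 * (1 / (1 + t\<^sup>2)))" by simp
qed

text \<open>In \<open>u = exp (- t)\<close> the product is a rational function regular at
  \<open>u = 0\<close>, so its limit at infinity is its value \<open>2 * c\<close> there.\<close>

lemma profile_exp_form:
  "exp t * profile c t = (4 * exp (- t) + 2 * c * (1 + (exp (- t))\<^sup>2)) / (1 + 2 * c * exp (- t) + (exp (- t))\<^sup>2)\<^sup>2"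
proof -
  define u where "u = exp (- t)"
  have u: "u > 0" by (simp add: u_def)
  have e: "exp t = 1 / u" by (simp add: u_def exp_minus inverse_eq_divide)
  have C: "cosh t = (1 + u\<^sup>2) / (2 * u)"
    unfolding cosh_field_def e u_def[symmetric] using u by (simp add: field_simps power2_eq_square)
  have D: "cosh t + c = (1 + 2 * c * u + u\<^sup>2) / (2 * u)"
    unfolding C using u by (simp add: field_simps)
  have N: "1 + c * cosh t = (2 * u + c * (1 + u\<^sup>2)) / (2 * u)"
    unfolding C using u by (simp add: field_simps)
  have nz: "1 + 2 * c * u + u\<^sup>2 \<noteq> 0" using D u cosh_plus_nz(1)[of t] by (metis div_0)
  have "exp t * profile c t = 1 / u * ((2 * u + c * (1 + u\<^sup>2)) / (2 * u) / ((1 + 2 * c * u + u\<^sup>2) / (2 * u))\<^sup>2)"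
    unfolding profile_def D N e ..
  also have "\<dots> = 2 * (2 * u + c * (1 + u\<^sup>2)) / (1 + 2 * c * u + u\<^sup>2)\<^sup>2"
  proof -
    have "1 / u * (a / (2 * u) / (b / (2 * u))\<^sup>2) = 2 * a / b\<^sup>2" if "b \<noteq> 0" for a b
      using u that by (simp add: power2_eq_square field_simps)
    from this[OF nz] show ?thesis .
  qed
  also have "2 * (2 * u + c * (1 + u\<^sup>2)) = 4 * u + 2 * c * (1 + u\<^sup>2)"
    by (simp add: algebra_simps)
  finally show ?thesis unfolding u_def .
qed

lemma profile_asymp: "((\<lambda>t. exp t * profile c t) \<longlongrightarrow> 2 * c) at_top"
proof -
  have e: "((\<lambda>t::real. exp (- t)) \<longlongrightarrow> 0) at_top" by real_asymp
  have "((\<lambda>t. (4 * exp (- t) + 2 * c * (1 + (exp (- t))\<^sup>2)) / (1 + 2 * c * exp (- t) + (exp (- t))\<^sup>2)\<^sup>2)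
     \<longlongrightarrow> (4 * 0 + 2 * c * (1 + 0\<^sup>2)) / (1 + 2 * c * 0 + 0\<^sup>2)\<^sup>2) at_top"
    by (intro tendsto_intros e) auto
  then show ?thesis unfolding profile_exp_form by simp
qed

lemma profile_at_top: "(profile c \<longlongrightarrow> 0) at_top"
proof -
  have e: "((\<lambda>t::real. exp (- t)) \<longlongrightarrow> 0) at_top" by real_asymp
  from tendsto_mult[OF e profile_asymp] show ?thesis
    by (simp add: mult.assoc[symmetric] exp_minus)
qed

lemma profile_at_bot: "(profile c \<longlongrightarrow> 0) at_bot"
  using profile_at_top unfolding filterlim_at_bot_mirror by simp

lemma profile_pos: "c \<ge> 0 \<Longrightarrow> profile c t > 0"
  unfolding profile_def using cosh_plus_pos[of t] cosh_real_pos[of t]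
  by (intro divide_pos_pos add_pos_nonneg) auto

lemma profile_deriv_neg:
  assumes "c \<ge> 0" "t > 0"
  shows "sinh t * (c\<^sup>2 - c * cosh t - 2) / (cosh t + c) ^ 3 < 0"
proof -
  have "c\<^sup>2 < 1" using c by (simp add: abs_square_less_1)
  moreover have "c * cosh t \<ge> 0" using assms cosh_real_nonneg[of t] by simp
  ultimately have "c\<^sup>2 - c * cosh t - 2 < 0" by linarith
  moreover have "sinh t > 0" using assms by simp
  ultimately show ?thesis using cosh_plus_pos[of t]
    by (intro divide_neg_pos mult_pos_neg) auto
qed

end

section \<open>The limit of the exponential tail at infinity for \<open>m < 1\<close>\<close>

lemma Beta_reflection_real:
  fixes m :: real
  assumes "0 < m"
  shows "Beta (1 + m) (1 - m) = m * pi / sin (m * pi)"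
proof -
  have "complex_of_real (Gamma m * Gamma (1 - m)) = Gamma (of_real m) * Gamma (1 - of_real m)"
    using Gamma_complex_of_real[of m] Gamma_complex_of_real[of "1 - m"] by simp
  also have "\<dots> = of_real (pi / sin (pi * m))"
    using sin_of_real[of "pi * m", where 'a = complex] by (simp add: Gamma_reflection_complex)
  finally have 1: "Gamma m * Gamma (1 - m) = pi / sin (pi * m)" by (simp only: of_real_eq_iff)
  have 2: "Gamma (1 + m) = m * Gamma m"
    using Gamma_plus1[of m] assms nonpos_Ints_nonpos[of m] by (auto simp: add.commute)
  have "Beta (1 + m) (1 - m) = Gamma (1 + m) * Gamma (1 - m)"
    by (simp add: Beta_def Gamma_numeral)
  also have "\<dots> = m * (pi / sin (pi * m))" unfolding 2 mult.assoc 1 ..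
  finally show ?thesis by (simp add: mult.commute)
qed

lemma one_plus_cosh_complex:
  "1 + cosh (Complex x y) = Complex (1 + cosh x * cos y) (sinh x * sin y)"
  by (simp add: complex_eq_iff Re_exp Im_exp cosh_field_def sinh_field_def field_simps)

text \<open>The zeros of \<open>1 + cosh\<close> are the odd multiples of \<open>\<i> * pi\<close>;
  the open strip avoids them and contains both lines of the contour shift.\<close>

lemma one_plus_cosh_nonzero:
  assumes "\<bar>Im z\<bar> < pi"
  shows "1 + cosh z \<noteq> 0"
proof
  assume "1 + cosh z = 0"
  moreover obtain x y where z: "z = Complex x y" by (cases z)
  ultimately have ch: "1 + cosh x * cos y = 0" and "sinh x * sin y = 0"
    by (simp_all add: one_plus_cosh_complex complex_eq_iff)
  then consider "x = 0" | "sin y = 0" by auto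
  moreover have y: "- pi < y" "y < pi" using assms z by auto
  ultimately show False
  proof cases
    case 1
    with ch have "cos \<bar>y\<bar> = cos pi" by simp
    moreover have "0 \<le> \<bar>y\<bar>" "\<bar>y\<bar> \<le> pi" "\<bar>y\<bar> < pi" using y by linarith+
    ultimately show False using cos_inj_pi[of "\<bar>y\<bar>" pi] by linarith
  next
    case 2
    then have "y = 0" using y by (simp add: sin_eq_0_pi)
    then show False using ch cosh_real_ge_1[of x] by simp
  qed
qed

text \<open>The squared modulus of \<open>1 + cosh (x + \<i> * a)\<close> is the perfect square
  \<open>(cosh x + cos a)^2\<close>, which is exactly the denominator of the profile.\<close>

lemma Re_inverse_one_plus_cosh:
  "Re (1 / (1 + cosh (Complex x a))) = profile (cos a) x"
proof -
  have "(sinh x)\<^sup>2 = (cosh x)\<^sup>2 - 1" by (simp add: cosh_square_eq)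
  moreover have "(sin a)\<^sup>2 = 1 - (cos a)\<^sup>2" by (simp add: sin_squared_eq)
  ultimately have "(1 + cosh x * cos a)\<^sup>2 + (sinh x * sin a)\<^sup>2 = (cosh x + cos a)\<^sup>2"
    by (simp only: power_mult_distrib) (simp add: power2_eq_square algebra_simps)
  then show ?thesis
    by (simp add: one_plus_cosh_complex profile_def Re_divide mult.commute)
qed

text \<open>Of \<open>exp z\<close> and \<open>exp (- z)\<close> one has modulus
  \<open>exp R\<close> and the other at most 1. The 3 collects this 1 and the doubled summand 1 of
  \<open>1 + cosh z\<close>.\<close>

lemma norm_one_plus_cosh_ge:
  assumes "\<bar>Re z\<bar> = R"
  shows "cmod (1 + cosh z) \<ge> (exp R - 3) / 2"
proof -
  have C: "2 * cosh z = exp z + exp (- z)" by (simp add: cosh_field_def)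
  have e: "exp R \<le> cmod (2 * cosh z) + 1"
  proof (cases "Re z \<ge> 0")
    case True
    then have "exp R = cmod (2 * cosh z - exp (- z))" using assms by (simp add: C)
    also have "\<dots> \<le> cmod (2 * cosh z) + cmod (exp (- z))" by (rule norm_triangle_ineq4)
    also have "cmod (exp (- z)) \<le> 1" using True by simp
    finally show ?thesis by simp
  next
    case False
    then have "exp R = cmod (2 * cosh z - exp z)" using assms by (simp add: C)
    also have "\<dots> \<le> cmod (2 * cosh z) + cmod (exp z)" by (rule norm_triangle_ineq4)
    also have "cmod (exp z) \<le> 1" using False by simp
    finally show ?thesis by simp
  qed
  have "cmod (cosh z) \<le> cmod (1 + cosh z) + 1"
    using norm_triangle_ineq4[of "1 + cosh z" 1] by simp
  with e show ?thesis by (simp add: norm_mult)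
qed

lemma logistic_bounds: "0 < exp s / (1 + exp s)" "exp s / (1 + exp s) < 1" for s :: real
  by (auto simp: add_pos_pos divide_simps) 

context
  fixes m :: real
  assumes m: "0 < m" "m < 1"
begin

text \<open>Substituting the logistic function into the Beta integral for \<open>B(1 + m, 1 - m)\<close> gives a
  primitive of \<open>exp (m * s) / (1 + cosh s)\<close>.\<close>

definition beta_primitive :: "real \<Rightarrow> real" where
  "beta_primitive s = 2 * integral {0..exp s / (1 + exp s)} (\<lambda>t. t powr m * (1 - t) powr (- m))"

lemma has_integral_beta_integrand:
  "((\<lambda>t. t powr m * (1 - t) powr (- m)) has_integral Beta (1 + m) (1 - m)) {0..1}"
  using has_integral_Beta_real[of "1 + m" "1 - m"] m by simp

lemma beta_primitive_deriv:
  "(beta_primitive has_real_derivative exp (m * s) / (1 + cosh s)) (at s)"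
proof -
  let ?f = "\<lambda>t::real. t powr m * (1 - t) powr (- m)"
  define u where "u = exp s / (1 + exp s)"
  have p: "1 + exp s > 0" by (simp add: add_pos_pos)
  have u: "0 < u" "u < 1" unfolding u_def by (rule logistic_bounds)+
  have "continuous (at u within {0..1}) ?f"
    using u by (intro continuous_intros) auto
  with u have "((\<lambda>x. integral {0..x} ?f) has_vector_derivative ?f u) (at u within {0..1})"
    using integral_has_vector_derivative_continuous_at[OF has_integral_integrable[OF has_integral_beta_integrand], of u "{}"] by simp
  then have 1: "((\<lambda>x. integral {0..x} ?f) has_real_derivative ?f u) (at u)"
    using u by (simp add: at_within_interior[of u "{0..1}"] has_real_derivative_iff_has_vector_derivative)
  have 2: "((\<lambda>s. exp s / (1 + exp s)) has_real_derivative exp s / (1 + exp s)\<^sup>2) (at s)"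
    using p by (auto intro!: derivative_eq_intros simp: power2_eq_square field_simps)
  have "(beta_primitive has_real_derivative 2 * (?f u * (exp s / (1 + exp s)\<^sup>2))) (at s)"
    unfolding beta_primitive_def[abs_def]
    using DERIV_cmult[OF DERIV_chain2[OF 1[unfolded u_def] 2]] unfolding u_def .
  moreover have "?f u = exp (m * s)"
  proof -
    have "1 - u = 1 / (1 + exp s)" using p by (simp add: u_def field_simps)
    then have "u / (1 - u) = exp s" using p by (simp add: u_def)
    then have "exp s powr m = u powr m / (1 - u) powr m" using u by (simp flip: powr_divide)
    then show ?thesis using u by (simp add: powr_minus divide_inverse exp_powr_real mult.commute)
  qed
  \<comment> \<open>This is the Jacobian of the logistic substitution; it accounts for the factor 2
    in \<open>beta_primitive\<close>.\<close>
  moreover have "2 * (exp s / (1 + exp s)\<^sup>2) = 1 / (1 + cosh s)"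
  proof -
    have "1 + cosh s = (1 + exp s)\<^sup>2 / (2 * exp s)"
      by (simp add: cosh_field_def exp_minus power2_eq_square field_simps)
    then show ?thesis by simp
  qed
  ultimately show ?thesis
    by (metis (no_types, lifting) mult.left_commute mult.right_neutral times_divide_eq_right)
qed

lemma beta_primitive_limits:
  "(beta_primitive \<longlongrightarrow> 2 * Beta (1 + m) (1 - m)) at_top"
  "((\<lambda>s. beta_primitive (- s)) \<longlongrightarrow> 0) at_top"
proof -
  let ?f = "\<lambda>t::real. t powr m * (1 - t) powr (- m)"
  have c: "continuous_on {0..1} (\<lambda>x. integral {0..x} ?f)"
    by (rule indefinite_integral_continuous_1[OF has_integral_integrable[OF has_integral_beta_integrand]])
  have 1: "((\<lambda>s::real. exp s / (1 + exp s)) \<longlongrightarrow> 1) at_top"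
    and 0: "((\<lambda>s::real. exp (- s) / (1 + exp (- s))) \<longlongrightarrow> 0) at_top" by real_asymp+
  have l: "\<forall>\<^sub>F s in at_top. exp s / (1 + exp s) \<in> {0..1::real}"
    "\<forall>\<^sub>F s in at_top. exp (- s) / (1 + exp (- s)) \<in> {0..1::real}"
    by (auto intro!: always_eventually less_imp_le[OF logistic_bounds(1)] less_imp_le[OF logistic_bounds(2)])
  from tendsto_mult_left[OF continuous_on_tendsto_compose[OF c 1 _ l(1)], of 2]
  show "(beta_primitive \<longlongrightarrow> 2 * Beta (1 + m) (1 - m)) at_top"
    unfolding beta_primitive_def[abs_def] using integral_unique[OF has_integral_beta_integrand] by simp
  from tendsto_mult_left[OF continuous_on_tendsto_compose[OF c 0 _ l(2)], of 2]
  show "((\<lambda>s. beta_primitive (- s)) \<longlongrightarrow> 0) at_top"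
    unfolding beta_primitive_def by simp
qed

text \<open>Since \<open>profile (cos a) s = Re (1 / (1 + cosh (s + \<i> * a)))\<close>, the integral over the real line is the
  real part of \<open>cis (- m * a)\<close> times the integral of \<open>exp (m * z) / (1 + cosh z)\<close> along
  \<open>Im z = a\<close>. That line can be shifted to \<open>Im z = 0\<close>, where the integral is a Beta value.\<close>

lemma exp_tail_profile_at_top:
  assumes a: "0 < a" "a < pi"
  shows "(exp_tail (profile (cos a)) m \<longlongrightarrow> 2 * (m * pi / sin (m * pi)) * cos (m * a)) at_top"
proof -
  have c: "\<bar>cos a\<bar> < 1"
  proof -
    have "cos a < 1" using cos_monotone_0_pi[of 0 a] a by simp
    moreover have "cos a > -1" using cos_monotone_0_pi[of a pi] a by simp
    ultimately show ?thesis by simp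
  qed
  note E = profile_continuous[OF c] profile_integrable[OF c] m(1)
  define S where "S = {z::complex. \<bar>Im z\<bar> < pi}"
  have "S = {z. Im z < pi} \<inter> {z. Im z > - pi}" by (auto simp: S_def)
  then have S: "open S" "convex S"
    by (auto intro!: open_Int convex_Int open_halfspace_Im_gt open_halfspace_Im_lt
        convex_halfspace_Im_gt convex_halfspace_Im_lt)
  define H where "H = (\<lambda>z::complex. exp (of_real m * z) / (1 + cosh z))"
  have "H holomorphic_on S"
    unfolding H_def cosh_field_def
    by (intro holomorphic_intros) (use one_plus_cosh_nonzero in \<open>auto simp: S_def cosh_field_def\<close>)
  from holomorphic_convex_primitive'[OF S(2,1) this]
  obtain P where P: "\<And>z. z \<in> S \<Longrightarrow> (P has_field_derivative H z) (at z within S)" by blast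
  have P': "(P has_field_derivative H z) (at z)" if "z \<in> S" for z
    using P[OF that] at_within_open[OF that S(1)] by argo
  have line: "((\<lambda>s. P (Complex s b)) has_vector_derivative H (Complex s b)) (at s)"
    if b: "\<bar>b\<bar> < pi" for b s
  proof -
    have "((\<lambda>z. P (z + Complex 0 b)) has_field_derivative H (of_real s + Complex 0 b)) (at (of_real s))"
      using P'[of "of_real s + Complex 0 b"] b by (simp add: DERIV_shift S_def)
    from has_vector_derivative_real_field[OF this, of UNIV]
    moreover have "of_real s + Complex 0 b = Complex s b" for s by (simp add: complex_eq_iff)
    ultimately show ?thesis by simp
  qed
  have side: "cmod (P (Complex s a) - P (Complex s 0)) \<le> 2 * exp (m * \<bar>s\<bar>) / (exp \<bar>s\<bar> - 3) * a"
    if s: "\<bar>s\<bar> > 2" for s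
  proof -
    define T where "T = {z. Re z = s} \<inter> {z. Im z \<ge> 0} \<inter> {z. Im z \<le> a}"
    have "cmod (P (Complex s a) - P (Complex s 0)) \<le>
      2 * exp (m * \<bar>s\<bar>) / (exp \<bar>s\<bar> - 3) * cmod (Complex s a - Complex s 0)"
    proof (rule field_differentiable_bound[where S = T])
      show "convex T" unfolding T_def
        by (intro convex_Int convex_halfspace_Im_ge convex_halfspace_Im_le) (simp add: convex_alt algebra_simps)
      show "Complex s a \<in> T" "Complex s 0 \<in> T" using a by (auto simp: T_def)
      fix z assume z: "z \<in> T"
      then have "z \<in> S" using a by (auto simp: T_def S_def)
      from P'[OF this] show "(P has_field_derivative H z) (at z within T)"
        by (rule has_field_derivative_at_within)
      have "exp \<bar>s\<bar> > 3" using exp_ge_add_one_self[of "\<bar>s\<bar>"] s by linarith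
      moreover have "cmod (1 + cosh z) \<ge> (exp \<bar>s\<bar> - 3) / 2"
        by (rule norm_one_plus_cosh_ge) (use z in \<open>simp add: T_def\<close>)
      moreover have "cmod (exp (of_real m * z)) \<le> exp (m * \<bar>s\<bar>)"
        using z m by (simp add: T_def mult_left_mono)
      ultimately have "cmod (H z) \<le> exp (m * \<bar>s\<bar>) / ((exp \<bar>s\<bar> - 3) / 2)"
        unfolding H_def norm_divide by (intro frac_le) auto
      then show "cmod (H z) \<le> 2 * exp (m * \<bar>s\<bar>) / (exp \<bar>s\<bar> - 3)" by (simp add: mult.commute)
    qed
    then show ?thesis using a by (simp add: cmod_def)
  qed
  \<comment> \<open>The sign \<epsilon> covers both ends of the strip at once. The bound is of order
    \<open>exp ((m - 1) * s)\<close> and decays because \<open>m < 1\<close>.\<close>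
  have side_lim: "((\<lambda>s. P (Complex (\<epsilon> * s) a) - P (Complex (\<epsilon> * s) 0)) \<longlongrightarrow> 0) at_top"
    if \<epsilon>: "\<bar>\<epsilon>\<bar> = 1" for \<epsilon> :: real
  proof (rule Lim_null_comparison)
    show "\<forall>\<^sub>F s in at_top. cmod (P (Complex (\<epsilon> * s) a) - P (Complex (\<epsilon> * s) 0))
        \<le> 2 * exp (m * s) / (exp s - 3) * a"
      using eventually_gt_at_top[of 2]
    proof eventually_elim
      case (elim s)
      then have "\<bar>\<epsilon> * s\<bar> = s" using \<epsilon> by (simp add: abs_mult)
      then show ?case using side[of "\<epsilon> * s"] elim by simp
    qed
    show "((\<lambda>s. 2 * exp (m * s) / (exp s - 3) * a) \<longlongrightarrow> 0) at_top"
      using m by real_asymp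
  qed
  \<comment> \<open>On the real axis \<open>P\<close> and \<open>beta_primitive\<close> have the
    same derivative, so they differ by a constant.\<close>
  have "((\<lambda>s. P (Complex s 0) - complex_of_real (beta_primitive s)) has_vector_derivative 0) (at s within UNIV)" for s
  proof -
    have "H (Complex s 0) = complex_of_real (exp (m * s) / (1 + cosh s))"
    proof -
      have "Complex s 0 = of_real s" by (simp add: complex_of_real_def)
      moreover have "cosh (complex_of_real s) = of_real (cosh s)"
        by (simp add: cosh_field_def flip: exp_of_real)
      moreover have "exp (of_real m * complex_of_real s) = of_real (exp (m * s))"
        by (simp flip: exp_of_real)
      ultimately show ?thesis unfolding H_def by simp
    qed
    moreover have "((\<lambda>s. complex_of_real (beta_primitive s)) has_vector_derivative complex_of_real (exp (m * s) / (1 + cosh s))) (at s)"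
      using beta_primitive_deriv[of s] by (rule has_vector_derivative_of_real)
    ultimately show ?thesis
      using has_vector_derivative_diff[OF line[of 0 s]] by fastforce
  qed
  from has_vector_derivative_zero_constant[OF convex_UNIV this]
  obtain k where "\<And>s. P (Complex s 0) - of_real (beta_primitive s) = k" by auto
  then have k: "P (Complex s 0) = k + of_real (beta_primitive s)" for s
    by (simp add: diff_eq_eq)
  \<comment> \<open>The factor \<open>cis (- (m * a))\<close> cancels the phase of
    \<open>exp (m * (s + \<i> * a))\<close>, so that taking real parts leaves
    \<open>exp (m * s)\<close> times the profile.\<close>
  define V where "V = (\<lambda>s. Re (cis (- (m * a)) * P (Complex s a)))"
  have "\<exists>k. \<forall>s\<in>UNIV. exp_tail (profile (cos a)) m s - V s = k"
  proof (rule has_field_derivative_zero_constant)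
    fix s :: real
    have "((\<lambda>s. cis (- (m * a)) * P (Complex s a)) has_vector_derivative cis (- (m * a)) * H (Complex s a)) (at s)"
      by (rule has_vector_derivative_mult_right[OF line]) (use a in auto)
    then have "(V has_real_derivative Re (cis (- (m * a)) * H (Complex s a))) (at s)"
      unfolding V_def has_real_derivative_iff_has_vector_derivative 
      by (rule bounded_linear.has_vector_derivative[OF bounded_linear_Re])
    also have "cis (- (m * a)) * H (Complex s a) = of_real (exp (m * s)) * (1 / (1 + cosh (Complex s a)))"
    proof -
      have "exp (of_real m * Complex s a) = of_real (exp (m * s)) * cis (m * a)"
        by (simp add: exp_eq_polar)
      then show ?thesis unfolding H_def by (simp add: cis_mult mult.left_commute)
    qed
    also have "Re \<dots> = exp (m * s) * profile (cos a) s"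
      by (simp only: scaleR_conv_of_real[symmetric] scaleR_complex.sel Re_inverse_one_plus_cosh)
    finally show "((\<lambda>s. exp_tail (profile (cos a)) m s - V s) has_real_derivative 0) (at s within UNIV)"
      using DERIV_diff[OF exp_tail_has_derivative[OF E, of s]] by fastforce
  qed simp
  then obtain k' where "\<And>s. exp_tail (profile (cos a)) m s - V s = k'" by auto
  then have k': "exp_tail (profile (cos a)) m s = k' + V s" for s
    by (simp add: diff_eq_eq)
  \<comment> \<open>Differences between \<open>s\<close> and \<open>- s\<close> eliminate the
    constants \<open>k\<close> and \<open>k'\<close>. What remains is the integral along the real
    axis plus the two vertical sides.\<close>
  have eq: "exp_tail (profile (cos a)) m s = exp_tail (profile (cos a)) m (- s) +
      Re (cis (- (m * a)) * (of_real (beta_primitive s - beta_primitive (- s))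
        + (P (Complex s a) - P (Complex s 0)) - (P (Complex (- s) a) - P (Complex (- s) 0))))" for s
    unfolding k' V_def k by (simp add: algebra_simps)
  have "((\<lambda>s. exp_tail (profile (cos a)) m (- s) +
      Re (cis (- (m * a)) * (of_real (beta_primitive s - beta_primitive (- s))
        + (P (Complex s a) - P (Complex s 0)) - (P (Complex (- s) a) - P (Complex (- s) 0)))))
     \<longlongrightarrow> 0 + Re (cis (- (m * a)) * (of_real (2 * Beta (1 + m) (1 - m) - 0) + 0 - 0))) at_top"
    by (intro tendsto_intros beta_primitive_limits side_lim[of 1, simplified] side_lim[of "-1", simplified]
        filterlim_compose[OF exp_tail_at_bot[OF E] filterlim_uminus_at_bot_at_top])
  then show ?thesis
    unfolding eq[symmetric] using Beta_reflection_real[OF m(1)] by (simp add: mult_ac)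
qed

end

section \<open>The rescaled surface profile\<close>

lemma exp_mult_at_bot: "m > 0 \<Longrightarrow> ((\<lambda>t::real. exp (m * t)) \<longlongrightarrow> 0) at_bot"
  by (rule filterlim_compose[OF exp_at_bot filterlim_tendsto_pos_mult_at_bot[OF tendsto_const _ filterlim_ident]])

lemma exp_mult_deriv: "((\<lambda>t::real. exp (m * t)) has_real_derivative exp (m * x) * m) (at x)"
  by (auto intro!: derivative_eq_intros)

lemma exp_mult_exp_mult: "exp a * (exp b * x) = exp (a + b) * x" for a b x :: real
  by (simp add: exp_add)

text \<open>The derivative may vanish at \<open>b\<close> itself, as it does in the applications
  with \<open>b = 0\<close>. Hence the two stages: a closed ray ending at \<open>b - 1\<close>, then
  an interval where only interior points count.\<close>

lemma pos_if_increasing_from_at_bot: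
  fixes G G' :: "real \<Rightarrow> real"
  assumes der: "\<And>x. (G has_real_derivative G' x) (at x)"
    and pos: "\<And>x. x < b \<Longrightarrow> G' x > 0" and lim: "(G \<longlongrightarrow> 0) at_bot"
  shows "G b > 0"
proof -
  have "0 < G (b - 1)"
  proof (rule DERIV_pos_imp_increasing_at_bot[OF _ lim])
    fix x assume "x \<le> b - 1"
    then show "\<exists>y. (G has_real_derivative y) (at x) \<and> 0 < y" using der pos[of x] by auto
  qed
  also have "G (b - 1) < G b"
    by (rule DERIV_pos_imp_increasing_open)
      (use der pos in \<open>auto intro!: DERIV_atLeastAtMost_imp_continuous_on exI\<close>)
  finally show ?thesis .
qed

text \<open>This is l'Hospital's rule of type 0/0 for \<open>G t / exp (- k * t)\<close>, moved to
  the right of 0 by \<open>t = 1 / x\<close>; the factors \<open>- t^2\<close> of the two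
  derivatives cancel.\<close>

lemma exp_weighted_limit:
  fixes G G' :: "real \<Rightarrow> real"
  assumes k: "k > 0" and der: "\<And>t. (G has_real_derivative G' t) (at t)"
    and lim: "(G \<longlongrightarrow> 0) at_top" and lim': "((\<lambda>t. exp (k * t) * G' t) \<longlongrightarrow> L) at_top"
  shows "((\<lambda>t. exp (k * t) * G t) \<longlongrightarrow> - L / k) at_top"
proof -
  have "((\<lambda>x. G (inverse x) / exp (- k * inverse x)) \<longlongrightarrow> - L / k) (at_right 0)"
  proof (rule lhopital_right_0)
    show "((\<lambda>x. G (inverse x)) \<longlongrightarrow> 0) (at_right 0)"
      using lim unfolding filterlim_at_top_to_right .
    have "((\<lambda>t. exp (- k * t)) \<longlongrightarrow> 0) at_top" using k by real_asymp
    then show "((\<lambda>x. exp (- k * inverse x)) \<longlongrightarrow> 0) (at_right 0)"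
      unfolding filterlim_at_top_to_right .
    have pos: "\<forall>\<^sub>F x in at_right 0. (0::real) < x" by (rule eventually_at_right_less)
    have inv: "(inverse has_real_derivative - (inverse x)\<^sup>2) (at x)" if "x > 0" for x :: real
      using DERIV_inverse[of x] that by (simp add: power2_eq_square)
    show "\<forall>\<^sub>F x in at_right 0. ((\<lambda>x. G (inverse x)) has_real_derivative G' (inverse x) * - (inverse x)\<^sup>2) (at x)"
      using pos by eventually_elim (rule DERIV_chain2[OF der inv])
    show "\<forall>\<^sub>F x in at_right 0. ((\<lambda>x. exp (- k * inverse x)) has_real_derivative
        exp (- k * inverse x) * (- k * - (inverse x)\<^sup>2)) (at x)"
      using pos by eventually_elim (rule DERIV_chain2[OF DERIV_exp DERIV_cmult[OF inv]])
    show "\<forall>\<^sub>F x in at_right 0. exp (- k * inverse x) * (- k * - (inverse x)\<^sup>2) \<noteq> 0"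
      using pos by eventually_elim (use k in auto)
    have "((\<lambda>t. exp (k * t) * G' t * (- 1 / k)) \<longlongrightarrow> L * (- 1 / k)) at_top"
      by (intro tendsto_intros lim')
    then have "((\<lambda>t. G' t * - t\<^sup>2 / (exp (- k * t) * (- k * - t\<^sup>2))) \<longlongrightarrow> L * (- 1 / k)) at_top"
    proof (rule Lim_transform_eventually)
      show "\<forall>\<^sub>F t in at_top. exp (k * t) * G' t * (- 1 / k) = G' t * - t\<^sup>2 / (exp (- k * t) * (- k * - t\<^sup>2))"
        using eventually_gt_at_top[of 0]
        by eventually_elim (use k in \<open>simp add: exp_minus field_simps\<close>)
    qed
    then show "((\<lambda>x. G' (inverse x) * - (inverse x)\<^sup>2 / (exp (- k * inverse x) * (- k * - (inverse x)\<^sup>2)))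
        \<longlongrightarrow> - L / k) (at_right 0)"
      unfolding filterlim_at_top_to_right by simp
  qed auto
  then have "((\<lambda>t. G t / exp (- k * t)) \<longlongrightarrow> - L / k) at_top"
    unfolding filterlim_at_top_to_right .
  then show ?thesis by (simp add: exp_minus divide_inverse mult.commute)
qed

text \<open>The convolution of the profile with \<open>exp (- m * \<bar>t\<bar>)\<close>, by \<open>exp_kernel_convolution\<close>.\<close>

definition conv_profile :: "real \<Rightarrow> real \<Rightarrow> real \<Rightarrow> real" where
  "conv_profile c m t = exp (- m * t) * exp_tail (profile c) m t + exp (m * t) * exp_tail (profile c) m (- t)"

lemma conv_profile_even [simp]: "conv_profile c m (- t) = conv_profile c m t"
  by (simp add: conv_profile_def)

context
  fixes c m :: real
  assumes c: "\<bar>c\<bar> < 1" and m: "m > 0"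
begin

abbreviation "tail \<equiv> exp_tail (profile c) m"

lemma profile_tail_deriv: "(tail has_real_derivative exp (m * t) * profile c t) (at t)"
  by (rule exp_tail_has_derivative[OF profile_continuous[OF c] profile_integrable[OF c] m])

lemma profile_tail_at_bot: "(tail \<longlongrightarrow> 0) at_bot"
  by (rule exp_tail_at_bot[OF profile_continuous[OF c] profile_integrable[OF c] m])

lemma profile_tail_mirror_deriv:
  "((\<lambda>t. tail (- t)) has_real_derivative - (exp (- m * t) * profile c t)) (at t)"
  using DERIV_mirror[of tail "exp (- m * t) * profile c t" t] profile_tail_deriv[of "- t"] by simp

lemma conv_profile_deriv:
  "(conv_profile c m has_real_derivative m * (exp (m * t) * tail (- t) - exp (- m * t) * tail t)) (at t)"
proof -
  have "exp (- m * t) * (exp (m * t) * x) = x" "exp (m * t) * (exp (- m * t) * x) = x" for x :: real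
    by (simp_all add: exp_minus)
  then show ?thesis unfolding conv_profile_def[abs_def]
    by (auto intro!: derivative_eq_intros profile_tail_deriv profile_tail_mirror_deriv simp: algebra_simps)
qed

text \<open>The terms from differentiating the tails cancel in the first derivative but add up to
  \<open>- 2 * m * f\<close> here: \<open>exp (- m * \<bar>t\<bar>)\<close> is \<open>2 * m\<close>
  times the Green's function of \<open>m^2 - d^2/dt^2\<close>.\<close>

lemma conv_profile_deriv2:
  "((\<lambda>t. m * (exp (m * t) * tail (- t) - exp (- m * t) * tail t)) has_real_derivative
     m\<^sup>2 * conv_profile c m t - 2 * m * profile c t) (at t)"
proof -
  have "exp (- m * t) * (exp (m * t) * x) = x" "exp (m * t) * (exp (- m * t) * x) = x" for x :: real
    by (simp_all add: exp_minus)
  then show ?thesis unfolding conv_profile_def[abs_def]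
    by (auto intro!: derivative_eq_intros profile_tail_deriv profile_tail_mirror_deriv
        simp: algebra_simps power2_eq_square)
qed

section \<open>Signs, curvature at the origin and monotonicity of the convolution\<close>

lemma profile_tail_zero_pos: "tail 0 > 0"
proof -
  \<comment> \<open>Integration by parts in differential form: \<open>?S\<close> vanishes at 0 and
    is negative to the left of it, so \<open>tail 0\<close> equals minus the integral of
    \<open>m * exp (m * s) * ?S s\<close>, which is positive.\<close>
  let ?S = "\<lambda>t. sinh t / (cosh t + c)"
  have "tail 0 - exp (m * 0) * ?S 0 > 0"
  proof (rule pos_if_increasing_from_at_bot[where b = 0 and G = "\<lambda>t. tail t - exp (m * t) * ?S t"])
    show "((\<lambda>t. tail t - exp (m * t) * ?S t) has_real_derivative - m * exp (m * x) * ?S x) (at x)" for x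
      by (rule DERIV_cong[OF DERIV_diff[OF profile_tail_deriv
              DERIV_mult[OF exp_mult_deriv profile_primitive[OF c]]]]) (simp add: algebra_simps)
    show "- m * exp (m * x) * ?S x > 0" if "x < 0" for x
      using that m cosh_plus_pos[OF c, of x] by (intro mult_neg_neg divide_neg_pos) auto
    have "((\<lambda>t. exp (m * t) * ?S t) \<longlongrightarrow> 0) at_bot"
    proof (rule Lim_null_comparison)
      show "\<forall>\<^sub>F t in at_bot. norm (exp (m * t) * ?S t) \<le> exp (m * t) * (1 / (1 - \<bar>c\<bar>))"
        unfolding norm_mult using profile_primitive_bound[OF c]
        by (intro always_eventually allI mult_mono) auto
      show "((\<lambda>t. exp (m * t) * (1 / (1 - \<bar>c\<bar>))) \<longlongrightarrow> 0) at_bot"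
        by (intro tendsto_mult_left_zero exp_mult_at_bot m)
    qed
    from tendsto_diff[OF profile_tail_at_bot this]
    show "((\<lambda>t. tail t - exp (m * t) * ?S t) \<longlongrightarrow> 0) at_bot" by simp
  qed
  then show ?thesis by simp
qed

lemma conv_profile_zero_pos: "conv_profile c m 0 > 0"
  using profile_tail_zero_pos by (simp add: conv_profile_def)

text \<open>The weight \<open>exp (m * s)\<close> has mass \<open>1 / m\<close> on the negative
  half-line, and the profile is below its value at 0 there, so
  \<open>m * tail 0 < profile c 0\<close>.\<close>

lemma conv_profile_deriv2_zero_neg: "m\<^sup>2 * conv_profile c m 0 - 2 * m * profile c 0 < 0"
proof -
  have "exp (m * 0) * (profile c 0 / m) - tail 0 > 0"
  proof (rule pos_if_increasing_from_at_bot[where b = 0 and G = "\<lambda>t. exp (m * t) * (profile c 0 / m) - tail t"])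
    show "((\<lambda>t. exp (m * t) * (profile c 0 / m) - tail t) has_real_derivative
        exp (m * x) * (profile c 0 - profile c x)) (at x)" for x
      using m by (auto intro!: derivative_eq_intros profile_tail_deriv simp: algebra_simps)
    show "exp (m * x) * (profile c 0 - profile c x) > 0" if "x < 0" for x
      using profile_lt_zero_value[OF c, of x] that by simp
    from tendsto_diff[OF tendsto_mult_left_zero[OF exp_mult_at_bot[OF m]] profile_tail_at_bot]
    show "((\<lambda>t. exp (m * t) * (profile c 0 / m) - tail t) \<longlongrightarrow> 0) at_bot"
      by (simp only: diff_self)
  qed
  then have "m * tail 0 < profile c 0" using m by (simp add: field_simps)
  then have "2 * m * (m * tail 0 - profile c 0) < 0" using m by (intro mult_pos_neg) auto
  then show ?thesis by (simp add: conv_profile_def power2_eq_square algebra_simps)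
qed

lemma profile_tail_pos:
  assumes "c \<ge> 0"
  shows "tail t > 0"
  by (rule pos_if_increasing_from_at_bot[OF profile_tail_deriv _ profile_tail_at_bot])
    (simp add: profile_pos[OF c assms])

lemma conv_profile_pos: "c \<ge> 0 \<Longrightarrow> conv_profile c m t > 0"
  unfolding conv_profile_def by (intro add_pos_pos mult_pos_pos profile_tail_pos) auto

text \<open>For \<open>c >= 0\<close> the profile increases up to 0, so its weighted mean over the
  points left of \<open>t\<close> is below its value at \<open>t\<close>.\<close>

lemma profile_tail_less:
  assumes "c \<ge> 0" "t \<le> 0"
  shows "tail t < exp (m * t) * (profile c t / m)"
proof -
  let ?d = "\<lambda>t. sinh t * (c\<^sup>2 - c * cosh t - 2) / (cosh t + c) ^ 3"
  have "exp (m * t) * (profile c t / m) - tail t > 0"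
  proof (rule pos_if_increasing_from_at_bot[where b = t and G = "\<lambda>t. exp (m * t) * (profile c t / m) - tail t"])
    show "((\<lambda>t. exp (m * t) * (profile c t / m) - tail t) has_real_derivative
        exp (m * x) * (?d x / m)) (at x)" for x
      by (rule DERIV_cong[OF DERIV_diff[OF DERIV_mult[OF exp_mult_deriv
              DERIV_cdivide[OF profile_deriv[OF c]]] profile_tail_deriv]]) (use m in simp)
    show "exp (m * x) * (?d x / m) > 0" if "x < t" for x
    proof -
      have "?d (- x) < 0" using that assms by (intro profile_deriv_neg[OF c]) auto
      then have "?d x > 0" by simp
      then show ?thesis by (intro mult_pos_pos[OF exp_gt_zero] divide_pos_pos[OF _ m])
    qed
    have "((\<lambda>t. exp (m * t) * (profile c t / m)) \<longlongrightarrow> 0 * (0 / m)) at_bot"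
      by (intro tendsto_intros exp_mult_at_bot profile_at_bot[OF c] m) (use m in auto)
    from tendsto_diff[OF this profile_tail_at_bot]
    show "((\<lambda>t. exp (m * t) * (profile c t / m) - tail t) \<longlongrightarrow> 0) at_bot"
      by (simp only: div_0 mult_zero_left diff_self)
  qed
  then show ?thesis by simp
qed

lemma conv_profile_deriv_neg:
  assumes "c \<ge> 0" "t > 0"
  shows "m * (exp (m * t) * tail (- t) - exp (- m * t) * tail t) < 0"
proof -
  \<comment> \<open>\<open>W\<close> is the derivative of the convolution times
    \<open>- exp (m * t) / m\<close>. It vanishes at 0, and \<open>profile_tail_less\<close> at
    \<open>- x\<close> is precisely the positivity of its derivative at \<open>x\<close>.\<close>
  define W where "W = (\<lambda>t. tail t - exp (2 * m * t) * tail (- t))"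
  have dW: "(W has_real_derivative 2 * (exp (m * x) * profile c x) - 2 * m * exp (2 * m * x) * tail (- x)) (at x)" for x
  proof -
    have "exp (2 * m * x) * (exp (- m * x) * y) = exp (m * x) * y" for y
      by (simp add: mult.assoc[symmetric] exp_add[symmetric])
    then show ?thesis unfolding W_def
      by (auto intro!: derivative_eq_intros profile_tail_deriv profile_tail_mirror_deriv simp: algebra_simps)
  qed
  have "W 0 < W t"
  proof (rule DERIV_pos_imp_increasing_open[OF assms(2)])
    fix x assume x: "0 < x" "x < t"
    have "tail (- x) < exp (m * - x) * (profile c (- x) / m)" using x assms by (intro profile_tail_less) auto
    then have "2 * m * exp (2 * m * x) * tail (- x) < 2 * m * exp (2 * m * x) * (exp (m * - x) * (profile c (- x) / m))"
      using m by (intro mult_strict_left_mono) auto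
    also have "\<dots> = 2 * (exp (2 * m * x) * exp (m * - x)) * profile c x" using m by simp
    also have "exp (2 * m * x) * exp (m * - x) = exp (m * x)" by (simp add: exp_add[symmetric])
    finally show "\<exists>y. (W has_real_derivative y) (at x) \<and> 0 < y" using dW[of x] by force
  qed (use dW in \<open>auto intro!: DERIV_atLeastAtMost_imp_continuous_on\<close>)
  then have "exp (2 * m * t) * tail (- t) - tail t < 0" by (simp add: W_def)
  then have "m * exp (- m * t) * (exp (2 * m * t) * tail (- t) - tail t) < 0" using m by (simp add: mult_pos_neg)
  also have "m * exp (- m * t) * (exp (2 * m * t) * tail (- t) - tail t)
    = m * ((exp (- m * t) * exp (2 * m * t)) * tail (- t) - exp (- m * t) * tail t)" by (simp add: algebra_simps)
  also have "exp (- m * t) * exp (2 * m * t) = exp (m * t)" by (simp add: exp_add[symmetric])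
  finally show ?thesis .
qed

lemma conv_profile_decreasing:
  assumes "c \<ge> 0" "0 \<le> s" "s < t"
  shows "conv_profile c m t < conv_profile c m s"
proof (rule DERIV_neg_imp_decreasing_open[OF assms(3)])
  fix x assume "s < x" "x < t"
  then show "\<exists>y. (conv_profile c m has_real_derivative y) (at x) \<and> y < 0"
    using conv_profile_deriv conv_profile_deriv_neg[of x] assms by force
qed (use conv_profile_deriv in \<open>blast intro: DERIV_atLeastAtMost_imp_continuous_on\<close>)

section \<open>Decay of the convolution at infinity\<close>

lemma profile_tail_left_asymp:
  "((\<lambda>t. exp ((m + 1) * t) * tail (- t)) \<longlongrightarrow> 2 * c / (m + 1)) at_top"
proof -
  have "((\<lambda>t. exp ((m + 1) * t) * tail (- t)) \<longlongrightarrow> - (- (2 * c)) / (m + 1)) at_top"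
  proof (rule exp_weighted_limit[OF _ profile_tail_mirror_deriv])
    show "((\<lambda>t. tail (- t)) \<longlongrightarrow> 0) at_top"
      by (rule filterlim_compose[OF profile_tail_at_bot filterlim_uminus_at_bot_at_top])
    have "exp ((m + 1) * t) * - (exp (- m * t) * profile c t) = - (exp t * profile c t)" for t
      unfolding mult_minus_right exp_mult_exp_mult by (simp add: algebra_simps)
    then show "((\<lambda>t. exp ((m + 1) * t) * - (exp (- m * t) * profile c t)) \<longlongrightarrow> - (2 * c)) at_top"
      using tendsto_minus[OF profile_asymp[OF c]] by (simp only:)
  qed (use m in auto)
  then show ?thesis by simp
qed

text \<open>For \<open>m > 1\<close> the comparison function \<open>exp ((m - 1) * t)\<close> grows,
  and l'Hospital's rule asks nothing of the limit of the tail. For \<open>m < 1\<close> that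
  function decays, and the rule of type 0/0 requires the tail to vanish at infinity; this
  alternative serves the borderline \<open>m * \<theta> = 1 / 2\<close>.\<close>

lemma profile_tail_right_asymp:
  assumes "m > 1 \<or> m < 1 \<and> (tail \<longlongrightarrow> 0) at_top"
  shows "((\<lambda>t. exp ((1 - m) * t) * tail t) \<longlongrightarrow> 2 * c / (m - 1)) at_top"
proof -
  have e: "exp ((1 - m) * t) * (exp (m * t) * profile c t) = exp t * profile c t" for t
    unfolding exp_mult_exp_mult by (simp add: algebra_simps)
  from assms show ?thesis
  proof
    assume m: "m > 1"
    have "((\<lambda>t. tail t / exp ((m - 1) * t)) \<longlongrightarrow> 2 * c / (m - 1)) at_top"
    proof (rule lhospital_at_top_at_top)
      show "filterlim (\<lambda>t. exp ((m - 1) * t)) at_top at_top" using m by real_asymp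
      show "\<forall>\<^sub>F t in at_top. ((\<lambda>t. exp ((m - 1) * t)) has_real_derivative exp ((m - 1) * t) * (m - 1)) (at t)"
        by (auto intro!: always_eventually derivative_eq_intros)
      show "\<forall>\<^sub>F t in at_top. exp ((m - 1) * t) * (m - 1) \<noteq> 0" using m by simp
      show "\<forall>\<^sub>F t in at_top. (tail has_real_derivative exp (m * t) * profile c t) (at t)"
        using profile_tail_deriv by simp
      have "exp (m * t) * profile c t / (exp ((m - 1) * t) * (m - 1)) = exp t * profile c t / (m - 1)" for t
      proof -
        have "inverse (exp ((m - 1) * t)) = exp ((1 - m) * t)"
          by (simp add: exp_minus[symmetric] algebra_simps)
        moreover have "exp (m * t) * profile c t / (exp ((m - 1) * t) * (m - 1))
            = inverse (exp ((m - 1) * t)) * (exp (m * t) * profile c t) / (m - 1)"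
          by (simp add: divide_inverse mult_ac)
        ultimately show ?thesis by (simp only: e)
      qed
      then show "((\<lambda>t. exp (m * t) * profile c t / (exp ((m - 1) * t) * (m - 1))) \<longlongrightarrow> 2 * c / (m - 1)) at_top"
        using tendsto_divide[OF profile_asymp[OF c] tendsto_const[of "m - 1"]] m by (simp only:)
    qed
    moreover have "tail t / exp ((m - 1) * t) = exp ((1 - m) * t) * tail t" for t
      by (simp add: divide_inverse exp_minus[symmetric] algebra_simps)
    ultimately show ?thesis by simp
  next
    assume m: "m < 1 \<and> (tail \<longlongrightarrow> 0) at_top"
    then have "((\<lambda>t. exp ((1 - m) * t) * tail t) \<longlongrightarrow> - (2 * c) / (1 - m)) at_top"
      using profile_asymp[OF c]
      by (intro exp_weighted_limit[OF _ profile_tail_deriv]) (simp_all add: e)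
    moreover have "- (2 * c) / (1 - m) = 2 * c / (m - 1)"
      using m by (simp add: divide_simps algebra_simps)
    ultimately show ?thesis by simp
  qed
qed

text \<open>Both summands of the convolution are weighed at the rate \<open>exp (- t)\<close>, and
  their limits \<open>2 * c / (m - 1)\<close> and \<open>2 * c / (m + 1)\<close> add up.\<close>

lemma conv_profile_asymp_exp:
  assumes "m > 1 \<or> m < 1 \<and> (tail \<longlongrightarrow> 0) at_top"
  shows "((\<lambda>t. conv_profile c m t * exp t) \<longlongrightarrow> 4 * m * c / (m\<^sup>2 - 1)) at_top"
proof -
  have "conv_profile c m t * exp t = exp ((1 - m) * t) * tail t + exp ((m + 1) * t) * tail (- t)" for t
  proof -
    have "exp ((1 - m) * t) = exp (- m * t) * exp t" "exp ((m + 1) * t) = exp (m * t) * exp t"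
      by (simp_all add: exp_add[symmetric] algebra_simps)
    then show ?thesis by (simp add: conv_profile_def algebra_simps)
  qed
  moreover have "2 * c / (m - 1) + 2 * c / (m + 1) = 4 * m * c / (m\<^sup>2 - 1)"
  proof -
    have "m - 1 \<noteq> 0" "m + 1 \<noteq> 0" using assms m by auto
    moreover have "m\<^sup>2 - 1 = (m - 1) * (m + 1)" by (simp add: power2_eq_square algebra_simps)
    ultimately show ?thesis by (simp add: add_frac_eq algebra_simps)
  qed
  ultimately show ?thesis
    using tendsto_add[OF profile_tail_right_asymp[OF assms] profile_tail_left_asymp] by simp
qed

text \<open>At \<open>m = 1\<close> the derivative of the tail tends to \<open>2 * c\<close>, which
  gives the linear factor; the other summand lacks that factor and drops out after division by
  \<open>t\<close>.\<close>

lemma conv_profile_asymp_resonant: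
  assumes "m = 1"
  shows "((\<lambda>t. conv_profile c m t * (exp t / t)) \<longlongrightarrow> 2 * c) at_top"
proof -
  have "((\<lambda>t. tail t / t) \<longlongrightarrow> 2 * c) at_top"
  proof (rule lhospital_at_top_at_top)
    show "\<forall>\<^sub>F t in at_top. (tail has_real_derivative exp (m * t) * profile c t) (at t)"
      using profile_tail_deriv by simp
    show "((\<lambda>t. exp (m * t) * profile c t / 1) \<longlongrightarrow> 2 * c) at_top"
      using profile_asymp[OF c] assms by simp
  qed (auto simp: filterlim_ident)
  moreover have "((\<lambda>t. exp ((m + 1) * t) * tail (- t) * inverse t) \<longlongrightarrow> 2 * c / (m + 1) * 0) at_top"
    by (intro tendsto_mult profile_tail_left_asymp tendsto_inverse_0_at_top filterlim_ident)
  ultimately have "((\<lambda>t. tail t / t + exp ((m + 1) * t) * tail (- t) * inverse t) \<longlongrightarrow> 2 * c + 2 * c / (m + 1) * 0) at_top"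
    by (rule tendsto_add)
  moreover have "tail t / t + exp ((m + 1) * t) * tail (- t) * inverse t = conv_profile c m t * (exp t / t)" for t
  proof -
    have "exp (- m * t) * exp t = 1" "exp ((m + 1) * t) = exp (m * t) * exp t"
      using assms by (simp_all add: exp_add[symmetric] algebra_simps)
    moreover have "conv_profile c m t * (exp t / t) = (exp (- m * t) * exp t) * tail t / t + (exp (m * t) * exp t) * tail (- t) / t"
      by (simp add: conv_profile_def add_divide_distrib algebra_simps)
    ultimately show ?thesis by (simp add: divide_inverse)
  qed
  ultimately show ?thesis by simp
qed

lemma conv_profile_asymp_slow:
  assumes "m < 1" "(tail \<longlongrightarrow> I) at_top"
  shows "((\<lambda>t. conv_profile c m t * exp (m * t)) \<longlongrightarrow> I) at_top"
proof -
  have "((\<lambda>t. exp ((m - 1) * t)) \<longlongrightarrow> 0) at_top" using assms by real_asymp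
  from tendsto_add[OF assms(2) tendsto_mult[OF this profile_tail_left_asymp]]
  have "((\<lambda>t. tail t + exp ((m - 1) * t) * (exp ((m + 1) * t) * tail (- t))) \<longlongrightarrow> I) at_top" by simp
  moreover have "tail t + exp ((m - 1) * t) * (exp ((m + 1) * t) * tail (- t)) = conv_profile c m t * exp (m * t)" for t
  proof -
    have "exp ((m - 1) * t) * exp ((m + 1) * t) = exp (m * t) * exp (m * t)" "exp (- m * t) * exp (m * t) = 1"
      by (simp_all add: exp_add[symmetric] algebra_simps)
    moreover have "conv_profile c m t * exp (m * t) = (exp (- m * t) * exp (m * t)) * tail t + (exp (m * t) * exp (m * t)) * tail (- t)"
      by (simp add: conv_profile_def algebra_simps)
    ultimately show ?thesis by (simp add: mult.assoc[symmetric])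
  qed
  ultimately show ?thesis by simp
qed

text \<open>Uniform in \<open>m\<close>, without the regimes above; the existence of crests needs
  only this.\<close>

lemma conv_profile_at_top: "(conv_profile c m \<longlongrightarrow> 0) at_top"
proof -
  have "((\<lambda>t. tail t / exp (m * t)) \<longlongrightarrow> 0) at_top"
  proof (rule lhospital_at_top_at_top)
    show "filterlim (\<lambda>t. exp (m * t)) at_top at_top" using m by real_asymp
    show "\<forall>\<^sub>F t in at_top. ((\<lambda>t. exp (m * t)) has_real_derivative exp (m * t) * m) (at t)"
      by (auto intro!: always_eventually derivative_eq_intros)
    show "\<forall>\<^sub>F t in at_top. exp (m * t) * m \<noteq> 0" using m by simp
    show "\<forall>\<^sub>F t in at_top. (tail has_real_derivative exp (m * t) * profile c t) (at t)"
      using profile_tail_deriv by simp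
    show "((\<lambda>t. exp (m * t) * profile c t / (exp (m * t) * m)) \<longlongrightarrow> 0) at_top"
      using tendsto_divide[OF profile_at_top[OF c] tendsto_const[of m]] m by simp
  qed
  moreover have "((\<lambda>t. exp (- t) * (exp ((m + 1) * t) * tail (- t))) \<longlongrightarrow> 0 * (2 * c / (m + 1))) at_top"
  proof (intro tendsto_mult profile_tail_left_asymp)
    show "((\<lambda>t::real. exp (- t)) \<longlongrightarrow> 0) at_top" by real_asymp
  qed
  ultimately have "((\<lambda>t. tail t / exp (m * t) + exp (- t) * (exp ((m + 1) * t) * tail (- t))) \<longlongrightarrow> 0 + 0 * (2 * c / (m + 1))) at_top"
    by (rule tendsto_add)
  moreover have "tail t / exp (m * t) + exp (- t) * (exp ((m + 1) * t) * tail (- t)) = conv_profile c m t" for t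
  proof -
    have "exp (- t) * exp ((m + 1) * t) = exp (m * t)"
      by (simp add: exp_add[symmetric] algebra_simps)
    then show ?thesis
      by (simp add: conv_profile_def exp_minus divide_inverse mult.assoc[symmetric] mult.commute)
  qed
  ultimately show ?thesis by simp
qed

end

section \<open>The shape of the surface\<close>

lemma eta2_eq_conv_profile:
  assumes g: "g > 0" and \<alpha>: "\<alpha> > 0" and h: "h > 0" and c: "\<bar>cos (pi * \<theta>)\<bar> < 1"
    and m: "m = sqrt g * h / (pi * \<alpha>)"
  shows "eta2 g \<alpha> h \<theta> x = - (1 / (16 * pi\<^sup>2 * \<alpha>\<^sup>2 * m)) * conv_profile (cos (pi * \<theta>)) m (pi * x / h)"
proof -
  define c where "c = cos (pi * \<theta>)"
  have m0: "m > 0" unfolding m using g \<alpha> h by simp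
  have chi: "chi h \<theta> = (\<lambda>y. 1 / (8 * h\<^sup>2) * profile c (0 + pi / h * y))"
    by (simp add: fun_eq_iff chi_def profile_def c_def)
  have int: "integrable lborel (chi h \<theta>)"
    unfolding chi using h c
    by (intro integrable_mult_right lborel_integrable_real_affine profile_integrable) (simp_all add: c_def)
  let ?f = "\<lambda>y. exp (- (sqrt g / \<alpha>) * \<bar>x - y\<bar>) * chi h \<theta> y"
  have eq: "?f (0 + h / pi * s) = 1 / (8 * h\<^sup>2) * (exp (- m * \<bar>pi * x / h - s\<bar>) * profile c s)" for s
  proof -
    have "x - h / pi * s = h / pi * (pi * x / h - s)" using h by (simp add: field_simps)
    then have "\<bar>x - h / pi * s\<bar> = h / pi * \<bar>pi * x / h - s\<bar>" using h by (simp only: abs_mult) simp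
    then have "- (sqrt g / \<alpha>) * \<bar>x - (0 + h / pi * s)\<bar> = - m * \<bar>pi * x / h - s\<bar>"
      by (simp add: m mult_ac)
    moreover have "chi h \<theta> (0 + h / pi * s) = 1 / (8 * h\<^sup>2) * profile c s"
      unfolding chi using h by simp
    ultimately show ?thesis by (simp only: mult.left_commute)
  qed
  have "(LINT y|lborel. ?f y) = \<bar>h / pi\<bar> *\<^sub>R (LINT s|lborel. ?f (0 + h / pi * s))"
    using h by (intro lborel_integral_real_affine) simp
  also have "\<dots> = h / pi * (1 / (8 * h\<^sup>2) * (LINT s|lborel. exp (- m * \<bar>pi * x / h - s\<bar>) * profile c s))"
    unfolding eq using h by simp
  also have "(LINT s|lborel. exp (- m * \<bar>pi * x / h - s\<bar>) * profile c s) = conv_profile c m (pi * x / h)"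
    unfolding conv_profile_def using c m0
    by (intro exp_kernel_convolution profile_continuous profile_integrable) (simp_all add: c_def)
  finally have "eta2 g \<alpha> h \<theta> x =
      - (1 / (2 * \<alpha> * sqrt g) * (h / pi * (1 / (8 * h\<^sup>2) * conv_profile c m (pi * x / h))))"
    unfolding eta2_def fourier_multiplier_symbol[OF g \<alpha> int] by simp
  also have "\<dots> = - (1 / (2 * \<alpha> * sqrt g) * (h / pi) * (1 / (8 * h\<^sup>2))) * conv_profile c m (pi * x / h)"
    by simp
  \<comment> \<open>Since \<open>sqrt g * h = pi * \<alpha> * m\<close>, the product
    \<open>16 * pi * \<alpha> * sqrt g * h\<close> becomes
    \<open>16 * pi^2 * \<alpha>^2 * m\<close>.\<close>
  also have "1 / (2 * \<alpha> * sqrt g) * (h / pi) * (1 / (8 * h\<^sup>2)) = 1 / (16 * pi\<^sup>2 * \<alpha>\<^sup>2 * m)"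
    unfolding m using g \<alpha> h by (simp add: power2_eq_square field_simps)
  finally show ?thesis unfolding c_def .
qed

lemma even_eventually_at_infinity:
  fixes f :: "real \<Rightarrow> 'a"
  assumes even: "\<And>x. f (- x) = f x" and ev: "\<forall>\<^sub>F x in at_top. P (f x)"
  shows "\<forall>\<^sub>F x in at_infinity. P (f x)"
proof -
  obtain N where N: "\<And>x. x \<ge> N \<Longrightarrow> P (f x)" using ev by (auto simp: eventually_at_top_linorder)
  have "P (f x)" if "norm x \<ge> N" for x
    using N[of "\<bar>x\<bar>"] even[of x] that by (cases "x \<ge> 0") auto
  then show ?thesis unfolding eventually_at_infinity by blast
qed

text \<open>Beyond some \<open>N\<close> the function stays below a positive value it has attained,
  so its maximum on \<open>[0, N]\<close> is global. It is not at 0, where the function is negative,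
  and evenness supplies the mirror image.\<close>

lemma even_function_crests:
  fixes f :: "real \<Rightarrow> real"
  assumes cont: "continuous_on UNIV f" and even: "\<And>x. f (- x) = f x" and neg: "f 0 < 0"
    and lim: "(f \<longlongrightarrow> 0) at_top" and ev: "\<forall>\<^sub>F x in at_top. f x > 0"
  shows "\<exists>x1 x2. x1 < 0 \<and> 0 < x2 \<and> is_crest f x1 \<and> is_crest f x2"
proof -
  obtain x0 where x0: "x0 > 0" "f x0 > 0"
    using eventually_happens[OF eventually_conj[OF ev eventually_gt_at_top[of 0]]] by auto
  obtain N where N: "\<And>x. x \<ge> N \<Longrightarrow> f x < f x0"
    using order_tendstoD(2)[OF lim x0(2)] by (auto simp: eventually_at_top_linorder)
  \<comment> \<open>Otherwise the choice of \<open>N\<close> would give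
    \<open>f x0 < f x0\<close>.\<close>
  have "x0 \<le> N" using N[of x0] by force
  obtain b where b: "b \<in> {0..N}" "\<And>y. y \<in> {0..N} \<Longrightarrow> f y \<le> f b"
    using continuous_attains_sup[of "{0..N}" f] continuous_on_subset[OF cont] x0 \<open>x0 \<le> N\<close> by auto
  have fb: "f x0 \<le> f b" using b(2)[of x0] x0 \<open>x0 \<le> N\<close> by auto
  have max: "f y \<le> f b" for y
  proof -
    have "f \<bar>y\<bar> \<le> f b" using b(2)[of "\<bar>y\<bar>"] N[of "\<bar>y\<bar>"] fb by (cases "\<bar>y\<bar> \<le> N") auto
    then show ?thesis using even[of y] by (cases "y \<ge> 0") auto
  qed
  have "b \<noteq> 0" using fb x0 neg by auto
  then have "b > 0" using b(1) by auto
  have "f b > 0" using fb x0 by linarith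
  then have "is_crest f b" "is_crest f (- b)"
    unfolding is_crest_def using max even[of b] by (auto intro!: exI[of _ 1])
  then show ?thesis using \<open>b > 0\<close> by (intro exI[of _ "- b"] exI[of _ b]) auto
qed

lemma eventually_sign_of_weighted_limit:
  fixes F w :: "real \<Rightarrow> real"
  assumes "((\<lambda>t. F t * w t) \<longlongrightarrow> L) at_top" and "\<forall>\<^sub>F t in at_top. w t > 0"
  shows "L < 0 \<Longrightarrow> \<forall>\<^sub>F t in at_top. F t < 0" and "L > 0 \<Longrightarrow> \<forall>\<^sub>F t in at_top. F t > 0"
proof -
  assume "L < 0"
  from order_tendstoD(2)[OF assms(1) this] assms(2)
  show "\<forall>\<^sub>F t in at_top. F t < 0" by eventually_elim (auto simp: mult_less_0_iff)
next
  assume "L > 0"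
  from order_tendstoD(1)[OF assms(1) this] assms(2)
  show "\<forall>\<^sub>F t in at_top. F t > 0" by eventually_elim (auto simp: zero_less_mult_iff)
qed

lemma abs_cos_less_one:
  assumes "0 < \<theta>" "\<theta> < 1"
  shows "\<bar>cos (pi * \<theta>)\<bar> < 1"
  using cos_monotone_0_pi[of 0 "pi * \<theta>"] cos_monotone_0_pi[of "pi * \<theta>" pi] assms by simp

lemma sin_mult_pi_pos: "0 < m \<Longrightarrow> m < 1 \<Longrightarrow> sin (m * pi) > 0"
  by (intro sin_gt_zero) auto

context
  fixes \<theta> m :: real
  assumes \<theta>: "0 < \<theta>" "\<theta> < 1" and m: "m > 0"
begin

lemma exp_tail_profile_cos_at_top:
  assumes "m < 1"
  shows "(exp_tail (profile (cos (pi * \<theta>))) m \<longlongrightarrow>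
      2 * (m * pi / sin (m * pi)) * cos (m * pi * \<theta>)) at_top"
  using exp_tail_profile_at_top[OF m assms, of "pi * \<theta>"] \<theta> by (simp add: mult.assoc)

lemma conv_profile_eventually_neg:
  assumes "\<theta> > 1 / 2" "m > 1 / (2 * \<theta>)"
  shows "\<forall>\<^sub>F t in at_top. conv_profile (cos (pi * \<theta>)) m t < 0"
proof -
  have c: "cos (pi * \<theta>) < 0"
    using cos_monotone_0_pi[of "pi / 2" "pi * \<theta>"] assms \<theta> by simp
  consider "m > 1" | "m = 1" | "m < 1" by linarith
  then show ?thesis
  proof cases
    case 1
    then have "m\<^sup>2 - 1 > 0" by simp
    then have "4 * m * cos (pi * \<theta>) / (m\<^sup>2 - 1) < 0"
      using c m by (intro divide_neg_pos mult_pos_neg) auto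
    then show ?thesis
      using eventually_sign_of_weighted_limit(1)[OF conv_profile_asymp_exp[OF abs_cos_less_one[OF \<theta>] m]] 1 by simp
  next
    case 2
    have "\<forall>\<^sub>F t::real in at_top. exp t / t > 0"
      using eventually_gt_at_top[of 0] by eventually_elim simp
    then show ?thesis
      using eventually_sign_of_weighted_limit(1)[OF conv_profile_asymp_resonant[OF abs_cos_less_one[OF \<theta>] m 2]] c by simp
  next
    case 3
    \<comment> \<open>Here \<open>m * pi * \<theta>\<close> lies strictly between
      \<open>pi / 2\<close> and \<open>pi\<close>, where the cosine is negative.\<close>
    have "m * \<theta> > 1 / 2" using assms \<theta> by (simp add: field_simps)
    moreover have "m * \<theta> < 1" using 3 \<theta> m by (metis mult_less_cancel_left2 less_trans mult_strict_mono' mult.right_neutral less_imp_le)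
    ultimately have "cos (m * pi * \<theta>) < cos (pi / 2)"
      by (intro cos_monotone_0_pi) (auto simp: field_simps)
    then have "2 * (m * pi / sin (m * pi)) * cos (m * pi * \<theta>) < 0"
      using m sin_mult_pi_pos[OF m 3] by (intro mult_pos_neg) auto
    then show ?thesis
      using eventually_sign_of_weighted_limit(1)[OF conv_profile_asymp_slow[OF abs_cos_less_one[OF \<theta>] m 3 exp_tail_profile_cos_at_top[OF 3]]]
      by simp
  qed
qed

lemma conv_profile_eventually_pos:
  assumes "\<theta> > 1 / 2" "m \<le> 1 / (2 * \<theta>)"
  shows "\<forall>\<^sub>F t in at_top. conv_profile (cos (pi * \<theta>)) m t > 0"
proof -
  have c: "cos (pi * \<theta>) < 0"
    using cos_monotone_0_pi[of "pi / 2" "pi * \<theta>"] assms \<theta> by simp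
  have m\<theta>: "m * \<theta> \<le> 1 / 2" using assms \<theta> by (simp add: field_simps)
  have "1 / (2 * \<theta>) < 1" using assms by (simp add: field_simps)
  then have m1: "m < 1" by (rule le_less_trans[OF assms(2)])
  show ?thesis
  proof (cases "m * \<theta> = 1 / 2")
    case True
    then have "cos (m * pi * \<theta>) = cos (pi / 2)" by (metis mult.assoc mult.commute times_divide_eq_right mult.right_neutral)
    then have z: "(exp_tail (profile (cos (pi * \<theta>))) m \<longlongrightarrow> 0) at_top"
      using exp_tail_profile_cos_at_top[OF m1] by simp
    have "m\<^sup>2 < 1" using m m1 by (simp add: abs_square_less_1)
    \<comment> \<open>The coefficient of \<open>exp (- t)\<close> takes over: a negative cosine over
      the negative \<open>m^2 - 1\<close>.\<close>
    then have "4 * m * cos (pi * \<theta>) / (m\<^sup>2 - 1) > 0"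
      using c m by (intro divide_neg_neg mult_pos_neg) auto
    then show ?thesis
      using eventually_sign_of_weighted_limit(2)[OF conv_profile_asymp_exp[OF abs_cos_less_one[OF \<theta>] m]] m1 z by simp
  next
    case False
    have "cos (m * pi * \<theta>) > 0"
      using m\<theta> False m \<theta> by (intro cos_gt_zero) (auto simp: field_simps)
    then have "2 * (m * pi / sin (m * pi)) * cos (m * pi * \<theta>) > 0"
      using m sin_mult_pi_pos[OF m m1] by (intro mult_pos_pos) auto
    then show ?thesis
      using eventually_sign_of_weighted_limit(2)[OF conv_profile_asymp_slow[OF abs_cos_less_one[OF \<theta>] m m1 exp_tail_profile_cos_at_top[OF m1]]]
      by simp
  qed
qed

end

theorem theorem4p4:
  fixes g \<alpha> h \<theta> m :: real
  assumes "g > 0" and "\<alpha> > 0" and "h > 0" and "0 < \<theta>" and "\<theta> < 1"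
    and m_def: "m = sqrt g * h / (pi * \<alpha>)"
  shows "eta2 g \<alpha> h \<theta> 0 < 0
    \<and> deriv (deriv (eta2 g \<alpha> h \<theta>)) 0 > 0
    \<and> (\<theta> \<le> 1/2 \<longrightarrow>
          (\<forall>x. eta2 g \<alpha> h \<theta> x < 0) \<and> strict_mono_on {0..} (eta2 g \<alpha> h \<theta>))
    \<and> (\<theta> > 1/2 \<and> m > 1 / (2 * \<theta>) \<longrightarrow>
          (\<forall>\<^sub>F x in at_infinity. eta2 g \<alpha> h \<theta> x > 0)
          \<and> (\<exists>x1 x2. x1 < 0 \<and> 0 < x2 \<and> is_crest (eta2 g \<alpha> h \<theta>) x1
                      \<and> is_crest (eta2 g \<alpha> h \<theta>) x2))
    \<and> (\<theta> > 1/2 \<and> m \<le> 1 / (2 * \<theta>) \<longrightarrow>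
          (\<forall>\<^sub>F x in at_infinity. eta2 g \<alpha> h \<theta> x < 0))
    \<and> (m > 1 \<longrightarrow>
          ((\<lambda>x. eta2 g \<alpha> h \<theta> x * exp (pi * x / h)) \<longlongrightarrow>
             - (2 / (m^2 - 1)) * (cos (pi * \<theta>) / (8 * pi^2 * \<alpha>^2))) at_top)
    \<and> (m = 1 \<longrightarrow>
          ((\<lambda>x. eta2 g \<alpha> h \<theta> x * (exp (pi * x / h) / (pi * x / h))) \<longlongrightarrow>
             - (cos (pi * \<theta>) / (8 * pi^2 * \<alpha>^2))) at_top)
    \<and> (m < 1 \<longrightarrow>
          ((\<lambda>x. eta2 g \<alpha> h \<theta> x * exp (sqrt g * x / \<alpha>)) \<longlongrightarrow>
             - (pi / sin (m * pi)) * (cos (m * pi * \<theta>) / (8 * pi^2 * \<alpha>^2))) at_top)"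
proof -
  note g = assms(1) and \<alpha> = assms(2) and h = assms(3) and \<theta> = assms(4,5)
  have m: "m > 0" unfolding m_def using g \<alpha> h by simp
  define c where "c = cos (pi * \<theta>)"
  have c1: "\<bar>c\<bar> < 1" unfolding c_def by (rule abs_cos_less_one[OF \<theta>])
  define K where "K = 1 / (16 * pi\<^sup>2 * \<alpha>\<^sup>2 * m)"
  have K: "K > 0" unfolding K_def using \<alpha> m by simp
  let ?F = "conv_profile c m"
  let ?\<eta> = "eta2 g \<alpha> h \<theta>"
  have eta: "?\<eta> = (\<lambda>x. - K * ?F (pi * x / h))"
    unfolding K_def c_def
    using eta2_eq_conv_profile[OF g \<alpha> h c1[unfolded c_def] m_def] by (intro ext)
  have even: "?\<eta> (- x) = ?\<eta> x" for x unfolding eta using conv_profile_even[of c m "pi * x / h"] by simp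
  have scale: "filterlim (\<lambda>x. pi * x / h) at_top at_top" using h by real_asymp
  have sdiv: "((\<lambda>x. pi * x / h) has_real_derivative pi / h) (at x)" for x
    using h by (auto intro!: derivative_eq_intros)
  have d1: "(?\<eta> has_real_derivative
      - K * (m * (exp (m * t) * exp_tail (profile c) m (- t) - exp (- m * t) * exp_tail (profile c) m t) * (pi / h))) (at x)"
    if "t = pi * x / h" for t x
    unfolding eta that by (rule DERIV_cmult[OF DERIV_chain2[OF conv_profile_deriv[OF c1 m] sdiv]])
  have d2: "((\<lambda>x. let t = pi * x / h in - K * (m * (exp (m * t) * exp_tail (profile c) m (- t)
        - exp (- m * t) * exp_tail (profile c) m t) * (pi / h))) has_real_derivative
      - K * ((m\<^sup>2 * ?F (pi * x / h) - 2 * m * profile c (pi * x / h)) * (pi / h) * (pi / h))) (at x)" for x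
    unfolding Let_def
    by (rule DERIV_cmult[OF DERIV_cmult_right[OF DERIV_chain2[OF conv_profile_deriv2[OF c1 m] sdiv]]])
  have "deriv (deriv ?\<eta>) 0 = - K * ((m\<^sup>2 * ?F 0 - 2 * m * profile c 0) * (pi / h) * (pi / h))"
  proof -
    \<comment> \<open>The first derivative has to be known as a function, not just at 0, before
      \<open>deriv\<close> can be applied to it again.\<close>
    have "deriv ?\<eta> = (\<lambda>x. let t = pi * x / h in - K * (m * (exp (m * t) * exp_tail (profile c) m (- t)
        - exp (- m * t) * exp_tail (profile c) m t) * (pi / h)))"
      unfolding Let_def by (intro ext DERIV_imp_deriv d1) simp
    then show ?thesis using DERIV_imp_deriv[OF d2[of 0]] by simp
  qed
  moreover have "(m\<^sup>2 * ?F 0 - 2 * m * profile c 0) * (pi / h) * (pi / h) < 0"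
    using conv_profile_deriv2_zero_neg[OF c1 m] h by (intro mult_neg_pos) auto
  ultimately have curv: "deriv (deriv ?\<eta>) 0 > 0" using K by (simp only: mult_neg_neg neg_less_0_iff_less)
  have trough: "?\<eta> 0 < 0" unfolding eta using K conv_profile_zero_pos[OF c1 m] by simp
  have small: "(\<forall>x. ?\<eta> x < 0) \<and> strict_mono_on {0..} ?\<eta>" if "\<theta> \<le> 1 / 2"
  proof -
    have c: "c \<ge> 0" unfolding c_def using that \<theta> by (intro cos_ge_zero) (auto intro: order_trans[of _ 0])
    have "?\<eta> x < 0" for x unfolding eta using K conv_profile_pos[OF c1 m c] by simp
    moreover have "strict_mono_on {0..} ?\<eta>"
    proof (rule strict_mono_onI)
      fix x y :: real assume xy: "x \<in> {0..}" "y \<in> {0..}" "x < y"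
      then have "0 \<le> pi * x / h" "pi * x / h < pi * y / h" using h by (auto simp: divide_strict_right_mono)
      from conv_profile_decreasing[OF c1 m c this] show "?\<eta> x < ?\<eta> y"
        unfolding eta using K by simp
    qed
    ultimately show ?thesis by blast
  qed
  have tall: "(\<forall>\<^sub>F x in at_infinity. ?\<eta> x > 0) \<and>
      (\<exists>x1 x2. x1 < 0 \<and> 0 < x2 \<and> is_crest ?\<eta> x1 \<and> is_crest ?\<eta> x2)"
    if "\<theta> > 1 / 2" "m > 1 / (2 * \<theta>)"
  proof -
    have ev: "\<forall>\<^sub>F x in at_top. ?\<eta> x > 0"
      using eventually_compose_filterlim[OF conv_profile_eventually_neg[OF \<theta> m that] scale]
      unfolding eta c_def[symmetric] by eventually_elim (use K in \<open>simp add: mult_pos_neg\<close>)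
    have "continuous_on UNIV ?\<eta>"
      by (rule DERIV_continuous_on) (rule d1[OF refl, THEN has_field_derivative_at_within])
    moreover have "(?\<eta> \<longlongrightarrow> 0) at_top"
      unfolding eta using filterlim_compose[OF conv_profile_at_top[OF c1 m] scale]
      by (intro tendsto_mult_right_zero)
    ultimately show ?thesis
      using even_function_crests[OF _ even trough _ ev] even_eventually_at_infinity[of ?\<eta> "\<lambda>y. y > 0", OF even ev] by blast
  qed
  have flat: "\<forall>\<^sub>F x in at_infinity. ?\<eta> x < 0" if "\<theta> > 1 / 2" "m \<le> 1 / (2 * \<theta>)"
  proof -
    have "\<forall>\<^sub>F x in at_top. ?\<eta> x < 0"
      using eventually_compose_filterlim[OF conv_profile_eventually_pos[OF \<theta> m that] scale]
      unfolding eta c_def[symmetric] by eventually_elim (use K in simp)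
    then show ?thesis using even_eventually_at_infinity[of ?\<eta> "\<lambda>y. y < 0", OF even] by blast
  qed
  \<comment> \<open>The weight is a function of \<open>t = pi * x / h\<close>, so all three
    asymptotic statements carry over with the factor \<open>- K\<close>; the \<open>m\<close> in the
    denominator of \<open>K\<close> cancels the one in the limits.\<close>
  have transfer: "((\<lambda>x. ?\<eta> x * w (pi * x / h)) \<longlongrightarrow> - K * L) at_top"
    if "((\<lambda>t. ?F t * w t) \<longlongrightarrow> L) at_top" for w :: "real \<Rightarrow> real" and L
    using tendsto_mult_left[OF filterlim_compose[OF that scale], of "- K"] unfolding eta
    by (simp add: mult.assoc)
  have fast: "((\<lambda>x. ?\<eta> x * exp (pi * x / h)) \<longlongrightarrow> - (2 / (m^2 - 1)) * (c / (8 * pi^2 * \<alpha>^2))) at_top"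
    if "m > 1"
  proof -
    have "- K * (4 * m * c / (m\<^sup>2 - 1)) = - (2 / (m^2 - 1)) * (c / (8 * pi^2 * \<alpha>^2))"
      unfolding K_def using m by simp
    then show ?thesis using transfer[OF conv_profile_asymp_exp[OF c1 m]] that by simp
  qed
  have resonant: "((\<lambda>x. ?\<eta> x * (exp (pi * x / h) / (pi * x / h))) \<longlongrightarrow> - (c / (8 * pi^2 * \<alpha>^2))) at_top"
    if "m = 1"
  proof -
    have "- K * (2 * c) = - (c / (8 * pi^2 * \<alpha>^2))" unfolding K_def that by simp
    then show ?thesis using transfer[OF conv_profile_asymp_resonant[OF c1 m that]] by simp
  qed
  have slow: "((\<lambda>x. ?\<eta> x * exp (sqrt g * x / \<alpha>)) \<longlongrightarrow>
      - (pi / sin (m * pi)) * (cos (m * pi * \<theta>) / (8 * pi^2 * \<alpha>^2))) at_top" if "m < 1"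
  proof -
    have "- K * (2 * (m * pi / sin (m * pi)) * cos (m * pi * \<theta>))
        = - (pi / sin (m * pi)) * (cos (m * pi * \<theta>) / (8 * pi^2 * \<alpha>^2))"
      unfolding K_def using m by simp
    moreover have "m * (pi * x / h) = sqrt g * x / \<alpha>" for x unfolding m_def using h by simp
    ultimately show ?thesis
      using transfer[OF conv_profile_asymp_slow[OF c1 m that exp_tail_profile_cos_at_top[OF \<theta> m that, folded c_def]]]
      by simp
  qed
  show ?thesis
    using trough curv small tall flat fast resonant slow unfolding c_def by blast
qed

end
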